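(* Let $\mu$ be a positive Borel measure on $\mathbb{C}$ with compact and infinite support. Let $\Omega$ denote a subdomain of the unbounded component of $\mathbb{C}\setminus\operatorname{supp}(\mu)$, and suppose that there is a function $g$ analytic and different from zero in $\Omega$ such that $$\lim_{n\to\infty}\frac{p_n^\mu(z)}{p_{n+1}^\mu(z)}=g(z)$$ uniformly on any compact subset of $\Omega$. Let $F$ be a compact subset of $\Omega$. Then $1/K_n^\mu(z,z)\to0$ uniformly for $z\in F$, and $$\lim_{n\to\infty}C_n^\mu(z,w)\,\frac{|p_n^\mu(z)|}{p_n^\mu(z)}\,\frac{p_n^\mu(w)}{|p_n^\mu(w)|}=\frac{\sqrt{(1-|g(z)|^2)(1-|g(w)|^2)}}{1-g(z)\overline{g(w)}}$$ uniformly for $z,w\in F$. Furthermore, let $z_1,\dots,z_\ell,w_1,\dots,w_\ell\in\Omega$ with distinct $g(z_1),\dots,g(z_\ell)$ and distinct $g(w_1),\dots,g(w_\ell)$. Then, uniformly for $z,w\in F$, $$\lim_{n\to\infty}\left|\frac{\det C_n^\mu(z_1,\dots,z_\ell,z;w_1,\dots,w_\ell,w)}{\det C_n^\mu(z_1,\dots,z_\ell;w_1,\dots,w_\ell)}\right| =\frac{\sqrt{(1-|g(z)|^2)(1-|g(w)|^2)}}{|1-g(z)\overline{g(w)}|}\prod_{j=1}^\ell\left|\frac{g(w)-g(w_j)}{1-g(z_j)\overline{g(w)}}\cdot\frac{g(z)-g(z_j)}{1-g(z)\overline{g(w_j)}}\right|.$$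
   Context: For a positive Borel measure $\mu$ on $\mathbb{C}$ with compact infinite support, $p_n^\mu$ ($n\ge0$) denotes the orthonormal polynomial of degree $n$ with positive leading coefficient: $\int p_n^\mu\overline{p_m^\mu}\,d\mu=\delta_{n,m}$. The Christoffel–Darboux kernel is $K_n^\mu(z,w)=\sum_{j=0}^np_j^\mu(z)\overline{p_j^\mu(w)}$, the cosine function is $C_n^\mu(z,w)=K_n^\mu(z,w)/\big(\sqrt{K_n^\mu(z,z)}\sqrt{K_n^\mu(w,w)}\big)$, and for points $x_1,\dots,x_m,y_1,\dots,y_m\in\mathbb{C}$, $C_n^\mu(x_1,\dots,x_m;y_1,\dots,y_m)$ is the $m\times m$ matrix $(C_n^\mu(x_j,y_k))_{j,k=1}^m$. *)

theory Defs
  imports "HOL-Complex_Analysis.Complex_Analysis" "Jordan_Normal_Form.Determinant"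
begin

definition measure_support :: "'a::topological_space measure \<Rightarrow> 'a set" where
  "measure_support M = {x. \<forall>U. open U \<and> x \<in> U \<longrightarrow> 0 < emeasure M U}"

definition orthonormal_polys :: "complex measure \<Rightarrow> (nat \<Rightarrow> complex poly) \<Rightarrow> bool" where
  "orthonormal_polys \<mu> p \<longleftrightarrow>
     (\<forall>n. degree (p n) = n \<and> (\<exists>c::real. 0 < c \<and> lead_coeff (p n) = complex_of_real c)) \<and>
     (\<forall>n m. (LINT z|\<mu>. poly (p n) z * cnj (poly (p m) z)) = (if n = m then 1 else 0))"

(* The theorem orthonormal_poly below shows that THE is well defined for finite Borel measures
   with compact infinite support. *)
definition orthonormal_poly :: "complex measure \<Rightarrow> nat \<Rightarrow> complex poly" where
  "orthonormal_poly \<mu> = (THE p. orthonormal_polys \<mu> p)"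

definition CD_kernel :: "complex measure \<Rightarrow> nat \<Rightarrow> complex \<Rightarrow> complex \<Rightarrow> complex" where
  "CD_kernel \<mu> n z w =
     (\<Sum>j\<le>n. poly (orthonormal_poly \<mu> j) z * cnj (poly (orthonormal_poly \<mu> j) w))"

(* CD_kernel mu n z z is real and nonnegative, so csqrt is the usual real square root here. *)
definition cosine_fun :: "complex measure \<Rightarrow> nat \<Rightarrow> complex \<Rightarrow> complex \<Rightarrow> complex" where
  "cosine_fun \<mu> n z w =
     CD_kernel \<mu> n z w / (csqrt (CD_kernel \<mu> n z z) * csqrt (CD_kernel \<mu> n w w))"

definition cosine_mat ::
  "complex measure \<Rightarrow> nat \<Rightarrow> complex list \<Rightarrow> complex list \<Rightarrow> complex mat" where
  "cosine_mat \<mu> n xs ys =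
     mat (length xs) (length ys) (\<lambda>(j, k). cosine_fun \<mu> n (xs ! j) (ys ! k))"

context
  fixes \<mu> :: "complex measure"
  assumes sets_mu: "sets \<mu> = sets borel"
    and fin_mu: "finite_measure \<mu>"
    and compact_supp: "compact (measure_support \<mu>)"
    and infinite_supp: "infinite (measure_support \<mu>)"
begin

private definition ip :: "complex poly \<Rightarrow> complex poly \<Rightarrow> complex" where
  "ip f g = (LINT z|\<mu>. poly f z * cnj (poly g z))"

lemma AE_measure_support: "AE z in \<mu>. z \<in> measure_support \<mu>"
proof -
  let ?F = "{U. open U \<and> emeasure \<mu> U = 0}"
  obtain F' where F': "F' \<subseteq> ?F" "countable F'" "\<Union>F' = \<Union>?F"
    using Lindelof[of ?F] by auto
  have "(\<Union>U\<in>F'. U) \<in> null_sets \<mu>"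
    by (rule null_sets_UN') (use F' sets_mu in \<open>auto simp: null_sets_def\<close>)
  moreover have "- measure_support \<mu> = \<Union>?F"
    by (auto simp: measure_support_def)
  ultimately have "- measure_support \<mu> \<in> null_sets \<mu>"
    using F'(3) by simp
  then show ?thesis
    using AE_not_in by fastforce
qed

lemma integrable_continuous_mu:
  fixes h :: "complex \<Rightarrow> complex"
  assumes "continuous_on UNIV h"
  shows "integrable \<mu> h"
proof -
  have "compact (h ` measure_support \<mu>)"
    using assms compact_supp compact_continuous_image continuous_on_subset by blast
  then obtain B where "\<forall>z\<in>measure_support \<mu>. norm (h z) \<le> B"
    using compact_imp_bounded bounded_iff by (metis imageI)
  then have "AE z in \<mu>. norm (h z) \<le> B"
    using AE_measure_support by (auto elim: eventually_mono)
  moreover have "h \<in> borel_measurable \<mu>"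
    using borel_measurable_continuous_onI[OF assms] sets_mu
    by (simp cong: measurable_cong_sets)
  ultimately show ?thesis
    by (rule finite_measure.integrable_const_bound[OF fin_mu])
qed

private lemma integrable_ip: "integrable \<mu> (\<lambda>z. poly f z * cnj (poly g z))"
  by (rule integrable_continuous_mu) (intro continuous_intros)

private lemma ip_add: "ip (f + g) h = ip f h + ip g h"
  unfolding ip_def by (simp add: distrib_right integrable_ip)

private lemma ip_smult: "ip (Polynomial.smult c f) h = c * ip f h"
  unfolding ip_def by (simp add: mult.assoc)

private lemma ip_cnj: "ip g f = cnj (ip f g)"
  unfolding ip_def by (subst integral_bounded_linear[OF bounded_linear_cnj integrable_ip, symmetric])
      (simp add: mult.commute)

private lemma ip_diff: "ip (f - g) h = ip f h - ip g h"
  unfolding ip_def by (simp add: left_diff_distrib integrable_ip)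

private lemma ip_zero: "ip 0 h = 0" "ip h 0 = 0"
  by (simp_all add: ip_def)

private lemma ip_sum: "ip (sum f A) h = (\<Sum>i\<in>A. ip (f i) h)"
  by (induction A rule: infinite_finite_induct) (auto simp: ip_add ip_zero)

private lemma ip_smult_right: "ip h (Polynomial.smult c f) = cnj c * ip h f"
  by (subst ip_cnj) (simp add: ip_smult flip: ip_cnj)

private lemma ip_diff_right: "ip h (f - g) = ip h f - ip h g"
  by (subst ip_cnj) (simp add: ip_diff flip: ip_cnj)

private lemma ip_self: "ip f f = complex_of_real (LINT z|\<mu>. (cmod (poly f z))\<^sup>2)"
  unfolding ip_def by (simp only: complex_norm_square[symmetric] integral_complex_of_real)

private lemma ip_self_pos:
  assumes "f \<noteq> 0"
  shows "\<exists>c::real. 0 < c \<and> ip f f = complex_of_real c"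
proof -
  let ?I = "LINT z|\<mu>. (cmod (poly f z))\<^sup>2"
  have int: "integrable \<mu> (\<lambda>z. (cmod (poly f z))\<^sup>2)"
  proof -
    have "integrable \<mu> (\<lambda>z. complex_of_real ((cmod (poly f z))\<^sup>2))"
      by (rule integrable_continuous_mu) (intro continuous_intros)
    then show ?thesis
      by (simp only: complex_of_real_integrable_eq)
  qed
  have "?I \<noteq> 0"
  proof
    assume "?I = 0"
    then have ae: "AE z in \<mu>. poly f z = 0"
      using integral_nonneg_eq_0_iff_AE[OF int] by simp
    have op: "open {z. poly f z \<noteq> 0}"
      by (intro open_Collect_neq continuous_intros)
    then have "{z. poly f z \<noteq> 0} \<in> sets \<mu>"
      using sets_mu by simp
    moreover have "space \<mu> = UNIV"
      using sets_eq_imp_space_eq[OF sets_mu] by simp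
    ultimately have "emeasure \<mu> {z. poly f z \<noteq> 0} = 0"
      using ae by (subst (asm) AE_iff_measurable[of "{z. poly f z \<noteq> 0}"]) auto
    with op have "measure_support \<mu> \<subseteq> {z. poly f z = 0}"
      by (auto simp: measure_support_def)
    with infinite_supp poly_roots_finite[OF assms] show False
      using finite_subset by blast
  qed
  then have "0 < ?I"
    by (simp add: less_le)
  then show ?thesis
    using ip_self by blast
qed

private definition monic_orth :: "nat \<Rightarrow> complex poly \<Rightarrow> bool" where
  "monic_orth n q \<longleftrightarrow>
     degree q = n \<and> lead_coeff q = 1 \<and> (\<forall>r. r = 0 \<or> degree r < n \<longrightarrow> ip r q = 0)"

private lemma degree_reduce:
  fixes r q :: "complex poly"
  assumes "degree q = degree r" "lead_coeff q = a" "a \<noteq> 0"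
  shows "r - Polynomial.smult (lead_coeff r / a) q = 0 \<or>
    degree (r - Polynomial.smult (lead_coeff r / a) q) < degree r"
proof (cases "degree r = 0")
  case True
  then show ?thesis
    using assms by (auto elim!: degree_eq_zeroE)
next
  case False
  let ?d = "r - Polynomial.smult (lead_coeff r / a) q"
  have "degree ?d \<le> degree r"
    using assms by (intro degree_diff_le) auto
  moreover have "coeff ?d (degree r) = 0"
    using assms by auto
  ultimately show ?thesis
    by (metis eq_zero_or_degree_less)
qed

private lemma orth_lower:
  assumes q: "\<And>k. k < n \<Longrightarrow> degree (q k) = k \<and> q k \<noteq> 0 \<and> ip (q k) h = 0"
    and r: "r = 0 \<or> degree r < n"
  shows "ip r h = 0"
  using r
proof (induction "degree r" arbitrary: r rule: less_induct)
  case less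
  show ?case
  proof (cases "r = 0")
    case True
    then show ?thesis by (simp add: ip_zero)
  next
    case False
    let ?k = "degree r"
    let ?c = "lead_coeff r / lead_coeff (q ?k)"
    have k: "?k < n"
      using False less.prems by simp
    have "r - Polynomial.smult ?c (q ?k) = 0 \<or> degree (r - Polynomial.smult ?c (q ?k)) < degree r"
    proof (rule degree_reduce[OF _ refl])
      show "degree (q ?k) = degree r"
        using q[OF k] by simp
      show "lead_coeff (q ?k) \<noteq> 0"
        using q[OF k] leading_coeff_0_iff by blast
    qed
    then have "ip (r - Polynomial.smult ?c (q ?k)) h = 0"
      using less.hyps less.prems k ip_zero by fastforce
    then show ?thesis
      using q[OF k] by (simp add: ip_diff ip_smult)
  qed
qed

private lemma monic_orth_exists: "\<exists>q. monic_orth n q"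
proof (induction n rule: less_induct)
  case (less n)
  then obtain q where q: "\<And>k. k < n \<Longrightarrow> monic_orth k (q k)"
    by metis
  have nz: "q k \<noteq> 0" if "k < n" for k
    using q[OF that] by (auto simp: monic_orth_def)
  have orth: "ip (q i) (q j) = 0" if "i < n" "j < n" "i \<noteq> j" for i j
  proof (cases "i < j")
    case True
    then show ?thesis
      using q[OF that(1)] q[OF that(2)] by (auto simp: monic_orth_def)
  next
    case False
    then have "ip (q j) (q i) = 0"
      using q[OF that(1)] q[OF that(2)] that by (auto simp: monic_orth_def)
    then show ?thesis
      by (subst ip_cnj) simp
  qed
  let ?X = "monom (1::complex) n"
  let ?S = "\<Sum>k<n. Polynomial.smult (ip ?X (q k) / ip (q k) (q k)) (q k)"
  have S: "coeff ?S i = 0" if "i \<ge> n" for i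
  proof -
    have "coeff (q k) i = 0" if "k < n" for k
      using q[OF that] \<open>i \<ge> n\<close> that by (intro coeff_eq_0) (auto simp: monic_orth_def)
    then show ?thesis
      by (auto simp: coeff_sum)
  qed
  have lc: "coeff (?X - ?S) n = 1"
    using S[of n] by simp
  have "degree (?X - ?S) \<le> n"
    using S by (intro degree_le) auto
  then have deg: "degree (?X - ?S) = n"
    using lc by (intro antisym le_degree) auto
  have "ip (q j) (?X - ?S) = 0" if j: "j < n" for j
  proof -
    have "ip ?S (q j) = (\<Sum>k<n. ip ?X (q k) / ip (q k) (q k) * ip (q k) (q j))"
      by (simp add: ip_sum ip_smult)
    also have "\<dots> = (\<Sum>k<n. if k = j then ip ?X (q j) else 0)"
      using orth j ip_self_pos[OF nz[OF j]] by (intro sum.cong) auto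
    also have "\<dots> = ip ?X (q j)"
      using j by simp
    finally have "ip (?X - ?S) (q j) = 0"
      by (simp add: ip_diff)
    then show ?thesis
      by (subst ip_cnj) simp
  qed
  then have "ip r (?X - ?S) = 0" if "r = 0 \<or> degree r < n" for r
    using q nz that by (intro orth_lower[where q = q and n = n]) (auto simp: monic_orth_def)
  then have "monic_orth n (?X - ?S)"
    unfolding monic_orth_def deg using lc by blast
  then show ?case
    by (rule exI)
qed

lemma orthonormal_polys_exist: "\<exists>p. orthonormal_polys \<mu> p"
proof -
  obtain q where q: "\<And>n. monic_orth n (q n)"
    using monic_orth_exists by metis
  then have nz: "q n \<noteq> 0" for n
    by (metis coeff_0 leading_coeff_0_iff monic_orth_def zero_neq_one)
  then have "\<forall>n. \<exists>c::real. 0 < c \<and> ip (q n) (q n) = complex_of_real c"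
    using ip_self_pos by blast
  then obtain c where c: "\<And>n. 0 < c n" "\<And>n. ip (q n) (q n) = complex_of_real (c n)"
    by metis
  define p where "p n = Polynomial.smult (complex_of_real (1 / sqrt (c n))) (q n)" for n
  have "degree (p n) = n" for n
    using q[of n] c(1)[of n] by (simp add: p_def monic_orth_def)
  moreover have "\<exists>a::real. 0 < a \<and> lead_coeff (p n) = complex_of_real a" for n
    using q[of n] c(1)[of n]
    by (intro exI[of _ "1 / sqrt (c n)"]) (auto simp: p_def monic_orth_def)
  moreover have "ip (p n) (p m) = (if n = m then 1 else 0)" for n m
  proof -
    have eq: "ip (p n) (p m) =
        complex_of_real (1 / sqrt (c n)) * complex_of_real (1 / sqrt (c m)) * ip (q n) (q m)"
      by (simp add: p_def ip_smult ip_smult_right)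
    consider "n < m" | "m < n" | "n = m"
      by linarith
    then show ?thesis
    proof cases
      case 1
      then have "ip (q n) (q m) = 0"
        using q[of n] q[of m] by (auto simp: monic_orth_def)
      then show ?thesis using eq 1 by simp
    next
      case 2
      then have "ip (q m) (q n) = 0"
        using q[of n] q[of m] by (auto simp: monic_orth_def)
      then have "ip (q n) (q m) = 0"
        by (subst ip_cnj) simp
      then show ?thesis using eq 2 by simp
    next
      case 3
      have "complex_of_real (1 / sqrt (c n)) * complex_of_real (1 / sqrt (c n)) *
          complex_of_real (c n) = complex_of_real (1 / sqrt (c n) * (1 / sqrt (c n)) * c n)"
        by (simp only: of_real_mult)
      also have "1 / sqrt (c n) * (1 / sqrt (c n)) * c n = 1"
        using c(1)[of n] by (simp add: field_simps)
      finally show ?thesis using eq 3 c(2) by simp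
    qed
  qed
  ultimately show ?thesis
    unfolding orthonormal_polys_def ip_def by blast
qed

lemma orthonormal_polys_unique:
  assumes "orthonormal_polys \<mu> p" "orthonormal_polys \<mu> p'"
  shows "p = p'"
proof
  fix n
  have lower: "ip r (q n) = 0" if q: "orthonormal_polys \<mu> q" and r: "r = 0 \<or> degree r < n" for q r
  proof (rule orth_lower[where q = q and n = n])
    fix k assume "k < n"
    then have "ip (q k) (q n) = 0"
      using q by (simp add: orthonormal_polys_def ip_def)
    moreover obtain c :: real where "0 < c" "lead_coeff (q k) = complex_of_real c"
      using q unfolding orthonormal_polys_def by blast
    then have "q k \<noteq> 0"
      by auto
    ultimately show "degree (q k) = k \<and> q k \<noteq> 0 \<and> ip (q k) (q n) = 0"
      using q by (simp add: orthonormal_polys_def)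
  qed (use r in simp)
  obtain a b where ab: "0 < a" "lead_coeff (p n) = complex_of_real a"
      "0 < b" "lead_coeff (p' n) = complex_of_real b"
    using assms unfolding orthonormal_polys_def by blast
  have deg: "degree (p n) = n" "degree (p' n) = n"
    using assms by (auto simp: orthonormal_polys_def)
  have norm: "ip (p n) (p n) = 1" "ip (p' n) (p' n) = 1"
    using assms by (auto simp: orthonormal_polys_def ip_def)
  let ?t = "complex_of_real (a / b)"
  let ?d = "p n - Polynomial.smult ?t (p' n)"
  have "?d = 0 \<or> degree ?d < n"
    using degree_reduce[of "p' n" "p n" "complex_of_real b"] deg ab by simp
  then have "ip ?d (p n) = 0" "ip ?d (p' n) = 0"
    using lower assms by auto
  then have "ip ?d ?d = 0"
    by (simp only: ip_diff_right ip_smult_right) simp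
  moreover have "ip ?d ?d \<noteq> 0" if "?d \<noteq> 0"
    using ip_self_pos[OF that] by (elim exE conjE) (simp only: of_real_eq_0_iff less_irrefl)
  ultimately have "?d = 0"
    by blast
  then have eq: "p n = Polynomial.smult ?t (p' n)"
    by (rule right_minus_eq[THEN iffD1])
  have "complex_of_real 1 = ip (p n) (p n)"
    using norm(1) by (simp only: of_real_1)
  also have "\<dots> = ?t * (cnj ?t * ip (p' n) (p' n))"
    by (simp only: eq ip_smult ip_smult_right mult.left_commute)
  also have "\<dots> = complex_of_real ((a / b)\<^sup>2)"
    by (simp only: norm(2) complex_cnj_complex_of_real of_real_mult power2_eq_square mult_1_right)
  finally have "(a / b)\<^sup>2 = 1"
    by (simp only: of_real_eq_iff)
  then have "a / b = 1"
    using divide_pos_pos[OF ab(1,3)] unfolding power2_eq_1_iff by linarith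
  then show "p n = p' n"
    using eq by (simp only: of_real_1 Polynomial.smult_1_left)
qed

theorem orthonormal_poly: "orthonormal_polys \<mu> (orthonormal_poly \<mu>)"
proof -
  obtain p where p: "orthonormal_polys \<mu> p"
    using orthonormal_polys_exist by (elim exE)
  show ?thesis
    unfolding orthonormal_poly_def
    by (rule theI[where P = "orthonormal_polys \<mu>", OF p]) (rule orthonormal_polys_unique[OF _ p])
qed

end

end

theory Submission
  imports Defs
begin

text \<open>
  Everything follows from the fact that, divided by \<open>p\<^sub>n(z)\<close> times the conjugate of \<open>p\<^sub>n(w)\<close>,
  the kernels satisfy an affine recursion. With \<open>r\<^sub>n = p\<^sub>n / p\<^sub>n\<^sub>+\<^sub>1\<close> the normalised kernels
  \<open>S\<^sub>n\<close> obey \<open>S\<^sub>n\<^sub>+\<^sub>1(z,w) = 1 + r\<^sub>n(z) cnj(r\<^sub>n(w)) S\<^sub>n(z,w)\<close>. The multiplier converges uniformly to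
  \<open>g(z) cnj(g(w))\<close>; as soon as this has modulus bounded by a constant below 1, the recursion is
  eventually a uniform contraction, and \<open>S\<^sub>n\<close> tends uniformly to the fixed point
  \<open>1 / (1 - g(z) cnj(g(w)))\<close> (\<open>uniform_limit_affine_recursion\<close>, \<open>kernel_ratio_limit\<close>). The cosine
  function with its phase factors is \<open>S\<^sub>n(z,w)\<close> divided by the square roots of \<open>S\<^sub>n(z,z)\<close> and
  \<open>S\<^sub>n(w,w)\<close>, which gives the second claim. The first is the geometric growth of \<open>p\<^sub>n\<close> forced by
  \<open>|g| < 1\<close>.

  The analytic input is therefore \<open>|g| < 1\<close> on \<open>\<Omega>\<close> (\<open>ratio_limit_less_one\<close>). A point \<open>a\<close> of the
  unbounded component of the complement of the support is separated from the support by a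
  polynomial \<open>q\<close> with \<open>q(a) = 1\<close> and \<open>|q| \<le> 1/2\<close> on the support (\<open>polynomial_peak\<close>). The Fourier
  coefficients of \<open>q\<^sup>k\<close> are then \<open>O(2\<^sup>-\<^sup>k)\<close>, while its value at \<open>a\<close> is 1; so \<open>p\<^sub>n(a)\<close> cannot
  have growth rate at most 1, which is what \<open>|g(a)| \<ge> 1\<close> would give.

  For the determinants, the phase factors and the factors \<open>sqrt(1 - |g|\<^sup>2)\<close> multiply rows and
  columns, so the limit is governed by the Cauchy-type matrix \<open>1 / (1 - a\<^sub>i b\<^sub>j)\<close>. Eliminating with
  its last entry as pivot leaves the smaller matrix of the same kind, with rescaled rows and
  columns (\<open>cauchy_det_step\<close>): the quotient of consecutive determinants is the asserted product, and
  the determinants for distinct nodes do not vanish.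
\<close>

section \<open>Polynomials that separate a point from a compact set\<close>

text \<open>
  The set of points admitting such a polynomial is open and relatively closed in \<open>U\<close>, and contains
  all points far from \<open>S\<close>. Since the bound \<open>1/2\<close> can be improved to \<open>1/4\<close> by squaring, a
  peak polynomial moves from \<open>a\<close> to \<open>b\<close> in a single step of pole pushing when \<open>b\<close> is eight times
  closer to \<open>a\<close> than \<open>S\<close> is: \<open>r(w) = (1 - q(w)\<^sup>2) / (w - a)\<close> is a polynomial approximating
  \<open>1 / (w - a)\<close> on \<open>S\<close>, and \<open>1 - (w - b) r(w)\<close> is 1 at \<open>b\<close> and at most \<open>1/8 + 1/4 + 1/32\<close> on \<open>S\<close>.
\<close>

lemma polynomial_peak:
  fixes S :: "complex set"
  assumes "compact S" and U: "U \<in> components (- S)" and unb: "\<not> bounded U" and "a \<in> U"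
  obtains q where "poly q a = 1" "\<And>w. w \<in> S \<Longrightarrow> cmod (poly q w) \<le> 1/2"
proof -
  define A where "A = {a \<in> U. \<exists>q. poly q a = 1 \<and> (\<forall>w\<in>S. cmod (poly q w) \<le> 1/2)}"
  have "open (- S)"
    using \<open>compact S\<close> by (simp add: compact_imp_closed open_Compl)
  then have opU: "open U"
    using U open_components by blast
  have conU: "connected U"
    using U in_components_connected by blast
  have US: "U \<subseteq> - S"
    using U in_components_subset by blast
  have step: "b \<in> A" if "a \<in> A" "b \<in> U" and near: "\<And>w. w \<in> S \<Longrightarrow> 8 * dist a b \<le> dist a w" for a b
  proof -
    obtain q where q: "poly q a = 1" "\<And>w. w \<in> S \<Longrightarrow> cmod (poly q w) \<le> 1/2"
      using \<open>a \<in> A\<close> unfolding A_def by blast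
    have "poly (1 - q * q) a = 0"
      using q(1) by simp
    then obtain r where r: "1 - q * q = [:- a, 1:] * r"
      unfolding poly_eq_0_iff_dvd by (elim dvdE)
    define q' where "q' = 1 - [:- b, 1:] * r"
    have "cmod (poly q' w) \<le> 1/2" if w: "w \<in> S" for w
    proof -
      have wa: "w - a \<noteq> 0"
        using US \<open>a \<in> A\<close> w unfolding A_def by auto
      define x y where "x = (b - a) / (w - a)" and "y = (poly q w)\<^sup>2"
      have "1 - y = (w - a) * poly r w"
        using arg_cong[OF r, of "\<lambda>f. poly f w"] by (simp add: y_def power2_eq_square algebra_simps)
      then have "poly r w = (1 - y) / (w - a)"
        using wa by (simp add: field_simps)
      moreover have "w - b = (1 - x) * (w - a)"
        using wa by (simp add: x_def field_simps)
      moreover have "poly q' w = 1 - (w - b) * poly r w"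
        by (simp add: q'_def algebra_simps)
      ultimately have "poly q' w = 1 - (1 - x) * (1 - y)"
        using wa by simp
      then have "poly q' w = x + y - x * y"
        by (simp add: algebra_simps)
      then have "cmod (poly q' w) \<le> cmod x + cmod y + cmod x * cmod y"
        using norm_triangle_ineq4[of "x + y" "x * y"] norm_triangle_ineq[of x y] by (simp add: norm_mult)
      moreover have x: "cmod x \<le> 1/8"
        using near[OF w] wa by (simp add: x_def norm_divide dist_norm norm_minus_commute field_simps)
      moreover have y: "cmod y \<le> 1/4"
        using power_mono[OF q(2)[OF w], of 2] by (simp add: y_def norm_mult power2_eq_square)
      moreover have "cmod x * cmod y \<le> 1/8 * (1/4)"
        using x y by (intro mult_mono) auto
      ultimately show ?thesis
        by linarith
    qed
    moreover have "poly q' b = 1"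
      by (simp add: q'_def)
    ultimately show ?thesis
      using \<open>b \<in> U\<close> unfolding A_def by blast
  qed
  have far: "r \<le> dist a w" if "ball a r \<subseteq> U" "w \<in> S" for a r w
    using that US by (meson ComplD linorder_not_le mem_ball subset_iff)
  have "open A"
    unfolding open_contains_ball
  proof
    fix a assume "a \<in> A"
    then obtain r where r: "0 < r" "ball a r \<subseteq> U"
      using opU open_contains_ball unfolding A_def by blast
    have "ball a (r/8) \<subseteq> A"
    proof
      fix b assume b: "b \<in> ball a (r/8)"
      with r have "b \<in> U" by auto
      show "b \<in> A"
        using far[OF r(2)] b by (intro step[OF \<open>a \<in> A\<close> \<open>b \<in> U\<close>]) force
    qed
    then show "\<exists>e>0. ball a e \<subseteq> A"
      using r(1) by (intro exI[of _ "r/8"]) simp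
  qed
  moreover have "open (U - A)"
    unfolding open_contains_ball
  proof
    fix a assume a: "a \<in> U - A"
    then obtain r where r: "0 < r" "ball a r \<subseteq> U"
      using opU open_contains_ball by blast
    have "b \<notin> A" if b: "b \<in> ball a (r/16)" for b
    proof
      assume "b \<in> A"
      have "8 * dist b a \<le> dist b w" if "w \<in> S" for w
      proof -
        have "r \<le> dist a w" by (rule far[OF r(2) that])
        moreover have "dist a w \<le> dist a b + dist b w" by (rule dist_triangle)
        moreover have "dist a b < r / 16" using b by simp
        ultimately show ?thesis using zero_le_dist[of a b] dist_commute[of b a] by linarith
      qed
      then have "a \<in> A"
        using step[OF \<open>b \<in> A\<close>, of a] a by blast
      then show False using a by simp
    qed
    moreover have "ball a (r/16) \<subseteq> U"
      using r by auto
    ultimately show "\<exists>e>0. ball a e \<subseteq> U - A"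
      using r(1) by (intro exI[of _ "r/16"]) auto
  qed
  moreover have "A \<noteq> {}"
  proof -
    obtain R where R: "0 < R" "\<And>w. w \<in> S \<Longrightarrow> cmod w \<le> R"
      using compact_imp_bounded[OF \<open>compact S\<close>] by (auto simp: bounded_pos)
    obtain b where b: "b \<in> U" "2 * R < cmod b"
      using unb by (meson bounded_iff not_le)
    \<comment> \<open>Far from \<open>S\<close> the linear polynomial \<open>w / b\<close> serves as a peak.\<close>
    have "cmod (poly [:0, 1 / b:] w) \<le> 1/2" if "w \<in> S" for w
    proof -
      have "0 < cmod b" "2 * cmod w \<le> cmod b"
        using R(1) R(2)[OF that] b(2) by linarith+
      then show ?thesis
        by (simp add: norm_divide divide_le_eq)
    qed
    moreover have "poly [:0, 1 / b:] b = 1"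
      using R(1) b(2) by auto
    ultimately have "b \<in> A"
      using b(1) unfolding A_def by blast
    then show ?thesis by blast
  qed
  moreover have "A \<subseteq> U"
    by (auto simp: A_def)
  ultimately have "U - A = {}"
    using connectedD[OF conU, of A "U - A"] by blast
  then show ?thesis
    using \<open>a \<in> U\<close> that unfolding A_def by blast
qed

section \<open>Ratio limits of orthonormal polynomials are smaller than 1\<close>

lemma graded_basis_spans:
  fixes p :: "nat \<Rightarrow> complex poly"
  assumes p: "\<And>n. degree (p n) = n" "\<And>n. lead_coeff (p n) \<noteq> 0"
    and f: "\<And>i. i \<ge> n \<Longrightarrow> coeff f i = 0"
  shows "\<exists>c. f = (\<Sum>j<n. Polynomial.smult (c j) (p j))"
  using f
proof (induction n arbitrary: f)
  case 0
  then have "f = 0" by (intro poly_eqI) simp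
  then show ?case by simp
next
  case (Suc n)
  let ?b = "coeff f n / lead_coeff (p n)"
  have "coeff (f - Polynomial.smult ?b (p n)) i = 0" if "i \<ge> n" for i
  proof (cases "i = n")
    case True
    then show ?thesis using p[of n] by simp
  next
    case False
    then have "coeff f i = 0" "coeff (p n) i = 0"
      using Suc.prems[of i] p(1)[of n] that by (auto intro: coeff_eq_0)
    then show ?thesis by simp
  qed
  then obtain c where c: "f - Polynomial.smult ?b (p n) = (\<Sum>j<n. Polynomial.smult (c j) (p j))"
    using Suc.IH by blast
  have "f = (\<Sum>j<Suc n. Polynomial.smult ((c(n := ?b)) j) (p j))"
    using c by (simp add: algebra_simps)
  then show ?case by blast
qed

context
  fixes \<mu> :: "complex measure"
  assumes mu: "sets \<mu> = sets borel" "finite_measure \<mu>"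
    "compact (measure_support \<mu>)" "infinite (measure_support \<mu>)"
begin

lemma orthonormal_expansion:
  assumes p: "orthonormal_polys \<mu> p" and f: "degree f < n"
  shows "f = (\<Sum>j<n. Polynomial.smult (LINT z|\<mu>. poly f z * cnj (poly (p j) z)) (p j))"
proof -
  have deg: "degree (p n) = n" and lc: "lead_coeff (p n) \<noteq> 0" for n
  proof -
    show "degree (p n) = n"
      using p by (simp add: orthonormal_polys_def)
    obtain c :: real where "0 < c" "lead_coeff (p n) = complex_of_real c"
      using p unfolding orthonormal_polys_def by blast
    then show "lead_coeff (p n) \<noteq> 0"
      by simp
  qed
  have "\<exists>c. f = (\<Sum>j<n. Polynomial.smult (c j) (p j))"
    by (rule graded_basis_spans[OF deg lc]) (use f in \<open>auto intro: coeff_eq_0\<close>)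
  then obtain c where c: "f = (\<Sum>j<n. Polynomial.smult (c j) (p j))"
    by blast
  have int: "integrable \<mu> (\<lambda>z. poly (p i) z * cnj (poly (p j) z))" for i j
    by (rule integrable_continuous_mu[OF mu]) (intro continuous_intros)
  have "(LINT z|\<mu>. poly f z * cnj (poly (p j) z)) = c j" if "j < n" for j
  proof -
    have "(LINT z|\<mu>. poly f z * cnj (poly (p j) z))
        = (LINT z|\<mu>. (\<Sum>i<n. c i * (poly (p i) z * cnj (poly (p j) z))))"
      by (subst c) (simp add: poly_sum sum_distrib_right mult.assoc)
    also have "\<dots> = (\<Sum>i<n. c i * (LINT z|\<mu>. poly (p i) z * cnj (poly (p j) z)))"
      using int by (subst Bochner_Integration.integral_sum) auto
    also have "\<dots> = (\<Sum>i<n. if i = j then c i else 0)"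
      using p by (intro sum.cong) (auto simp: orthonormal_polys_def)
    finally show ?thesis
      using that by simp
  qed
  then show ?thesis
    by (subst c) (intro sum.cong, auto)
qed

text \<open>
  Integrate \<open>|f| |p\<^sub>j| \<le> B (1 + |p\<^sub>j|\<^sup>2)\<close> and use that \<open>p\<^sub>j\<close> has norm 1. What matters below
  is that the bound is linear in \<open>B\<close> and independent of \<open>j\<close>.
\<close>

lemma fourier_coefficient_bound:
  assumes p: "orthonormal_polys \<mu> p"
    and f: "\<And>w. w \<in> measure_support \<mu> \<Longrightarrow> cmod (poly f w) \<le> B"
  shows "cmod (LINT z|\<mu>. poly f z * cnj (poly (p j) z)) \<le> B * (measure \<mu> (space \<mu>) + 1)"
proof -
  interpret finite_measure \<mu> by (rule mu(2))
  have int: "integrable \<mu> (\<lambda>z. poly f z * cnj (poly (p j) z))"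
    by (rule integrable_continuous_mu[OF mu]) (intro continuous_intros)
  have "integrable \<mu> (\<lambda>z. complex_of_real ((cmod (poly (p j) z))\<^sup>2))"
    by (rule integrable_continuous_mu[OF mu]) (intro continuous_intros)
  then have int2: "integrable \<mu> (\<lambda>z. (cmod (poly (p j) z))\<^sup>2)"
    by (simp only: complex_of_real_integrable_eq)
  have "complex_of_real (LINT z|\<mu>. (cmod (poly (p j) z))\<^sup>2)
      = (LINT z|\<mu>. poly (p j) z * cnj (poly (p j) z))"
    by (simp only: complex_norm_square[symmetric] integral_complex_of_real)
  also have "\<dots> = complex_of_real 1"
    using p by (simp add: orthonormal_polys_def)
  finally have norm1: "(LINT z|\<mu>. (cmod (poly (p j) z))\<^sup>2) = 1"
    by (simp only: of_real_eq_iff)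
  have "cmod (LINT z|\<mu>. poly f z * cnj (poly (p j) z))
      \<le> (LINT z|\<mu>. cmod (poly f z * cnj (poly (p j) z)))"
    by (rule integral_norm_bound)
  also have "\<dots> \<le> (LINT z|\<mu>. B * (1 + (cmod (poly (p j) z))\<^sup>2))"
  proof (rule integral_mono_AE)
    show "AE z in \<mu>. cmod (poly f z * cnj (poly (p j) z)) \<le> B * (1 + (cmod (poly (p j) z))\<^sup>2)"
      using AE_measure_support[OF mu]
    proof (rule AE_mp, intro AE_I2 impI)
      fix z assume z: "z \<in> measure_support \<mu>"
      define x where "x = cmod (poly (p j) z)"
      have "0 \<le> x"
        by (simp add: x_def)
      then have "x \<le> 1 + x\<^sup>2"
        using zero_le_power2[of "x - 1"] unfolding power2_diff by simp
      then have "cmod (poly f z) * x \<le> B * (1 + x\<^sup>2)"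
        using f[OF z] \<open>0 \<le> x\<close> order_trans[OF norm_ge_zero f[OF z]] by (intro mult_mono) auto
      then show "cmod (poly f z * cnj (poly (p j) z)) \<le> B * (1 + (cmod (poly (p j) z))\<^sup>2)"
        by (simp add: norm_mult x_def)
    qed
  qed (use int int2 in auto)
  also have "\<dots> = B * (measure \<mu> (space \<mu>) + 1)"
    using int2 norm1 by simp
  finally show ?thesis .
qed

text \<open>
  If \<open>|\<gamma>| \<ge> 1\<close>, then \<open>|p\<^sub>n(a)| \<le> C t\<^sup>n\<close> for every \<open>t > 1\<close> and a suitable \<open>C\<close>. Expanding the
  \<open>k\<close>-th power of a peak polynomial of degree \<open>d\<close> in the basis \<open>p\<^sub>j\<close> and evaluating at \<open>a\<close> gives
  \<open>1 \<le> (k d + 1) M C (t\<^sup>d / 2)\<^sup>k\<close> with \<open>M\<close> independent of \<open>k\<close>, which fails for large \<open>k\<close> when \<open>t\<close> is so close to 1 that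
  \<open>t\<^sup>d < 3/2\<close>.
\<close>

lemma ratio_limit_less_one:
  assumes p: "orthonormal_polys \<mu> p"
    and U: "U \<in> components (- measure_support \<mu>)" "\<not> bounded U" "a \<in> U"
    and lim: "(\<lambda>n. poly (p n) a / poly (p (Suc n)) a) \<longlonglongrightarrow> \<gamma>"
  shows "cmod \<gamma> < 1"
proof (rule ccontr)
  assume "\<not> cmod \<gamma> < 1"
  obtain q where q: "poly q a = 1" "\<And>w. w \<in> measure_support \<mu> \<Longrightarrow> cmod (poly q w) \<le> 1/2"
    using polynomial_peak[OF mu(3) U] by blast
  define d where "d = degree q"
  obtain t :: real where t: "1 < t" "t ^ d < 3/2"
  proof -
    have "((\<lambda>t::real. t ^ d) \<longlongrightarrow> 1 ^ d) (at_right 1)"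
      by (intro tendsto_intros)
    then have "\<forall>\<^sub>F t in at_right (1::real). t ^ d < 3/2"
      by (rule order_tendstoD) simp
    then have "\<forall>\<^sub>F t in at_right (1::real). 1 < t \<and> t ^ d < 3/2"
      using eventually_at_right_less by (rule eventually_elim2) blast
    then show ?thesis
      using that eventually_happens[of _ "at_right (1::real)"] trivial_limit_at_right_real by blast
  qed
  let ?x = "\<lambda>n. cmod (poly (p n) a)"
  have "(\<lambda>n. ?x n / ?x (Suc n)) \<longlonglongrightarrow> cmod \<gamma>"
    using tendsto_norm[OF lim] by (simp add: norm_divide)
  moreover have "1 / t < 1"
    using t(1) by simp
  then have "1 / t < cmod \<gamma>"
    using \<open>\<not> cmod \<gamma> < 1\<close> by linarith
  ultimately have "\<forall>\<^sub>F n in sequentially. 1 / t < ?x n / ?x (Suc n)"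
    by (rule order_tendstoD)
  then obtain N where N: "\<And>n. n \<ge> N \<Longrightarrow> 1 / t < ?x n / ?x (Suc n)"
    unfolding eventually_sequentially by blast
  have ratio: "?x (Suc n) \<le> t * ?x n" if "n \<ge> N" for n
  proof -
    have "?x (Suc n) > 0"
      using N[OF that] t(1) by (auto simp: less_le)
    then show ?thesis
      using N[OF that] t(1) by (simp add: field_simps)
  qed
  define C where "C = (\<Sum>j\<le>N. ?x j)"
  have "C \<ge> 0"
    by (simp add: C_def sum_nonneg)
  have bound: "?x n \<le> C * t ^ n" for n
  proof (induction n)
    case 0
    show ?case
      using member_le_sum[of 0 "{..N}" ?x] by (simp add: C_def)
  next
    case (Suc n)
    show ?case
    proof (cases "Suc n \<le> N")
      case True
      then have "?x (Suc n) \<le> C * 1"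
        using member_le_sum[of "Suc n" "{..N}" ?x] by (simp add: C_def)
      also have "\<dots> \<le> C * t ^ Suc n"
        using \<open>C \<ge> 0\<close> t(1) by (intro mult_left_mono one_le_power) auto
      finally show ?thesis .
    next
      case False
      then have "?x (Suc n) \<le> t * ?x n"
        using ratio by simp
      also have "\<dots> \<le> t * (C * t ^ n)"
        using Suc t(1) by (intro mult_left_mono) auto
      finally show ?thesis
        by (simp add: mult_ac)
    qed
  qed
  define M where "M = measure \<mu> (space \<mu>) + 1"
  have "M \<ge> 0" by (simp add: M_def)
  have key: "1 \<le> real (Suc (k * d)) * ((3/4) ^ k * (M * C))" for k
  proof -
    define c where "c j = (LINT z|\<mu>. poly (q ^ k) z * cnj (poly (p j) z))" for j
    have "degree (q ^ k) < Suc (k * d)"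
      using degree_power_le[of q k] by (simp add: d_def mult.commute less_Suc_eq_le)
    then have exp: "q ^ k = (\<Sum>j<Suc (k * d). Polynomial.smult (c j) (p j))"
      unfolding c_def by (rule orthonormal_expansion[OF p])
    have small: "cmod (poly (q ^ k) w) \<le> (1/2) ^ k" if "w \<in> measure_support \<mu>" for w
      using power_mono[OF q(2)[OF that], of k] by (simp add: norm_power poly_power)
    have cb: "cmod (c j) \<le> (1/2) ^ k * M" for j
      unfolding c_def M_def by (rule fourier_coefficient_bound[OF p small])
    have "1 = poly (q ^ k) a"
      using q(1) by (simp add: poly_power)
    also have "\<dots> = (\<Sum>j<Suc (k * d). c j * poly (p j) a)"
      by (subst exp) (simp add: poly_sum)
    finally have "1 = cmod (\<Sum>j<Suc (k * d). c j * poly (p j) a)"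
      by (metis norm_one)
    also have "\<dots> \<le> (\<Sum>j<Suc (k * d). cmod (c j * poly (p j) a))"
      by (rule norm_sum)
    also have "\<dots> \<le> (\<Sum>j<Suc (k * d). (3/4) ^ k * (M * C))"
    proof (rule sum_mono)
      fix j assume "j \<in> {..<Suc (k * d)}"
      then have "t ^ j \<le> t ^ (k * d)"
        using t(1) by (intro power_increasing) auto
      also have "\<dots> = (t ^ d) ^ k"
        by (metis mult.commute power_mult)
      also have "\<dots> \<le> (3/2) ^ k"
        using t by (intro power_mono) auto
      finally have "?x j \<le> C * (3/2) ^ k"
        using bound[of j] \<open>C \<ge> 0\<close> by (meson mult_left_mono order_trans)
      then have "cmod (c j * poly (p j) a) \<le> ((1/2) ^ k * M) * (C * (3/2) ^ k)"
        unfolding norm_mult using cb \<open>M \<ge> 0\<close> by (intro mult_mono) auto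
      also have "\<dots> = ((1/2) * (3/2)) ^ k * (M * C)"
        unfolding power_mult_distrib by (simp only: mult_ac)
      finally show "cmod (c j * poly (p j) a) \<le> (3/4) ^ k * (M * C)"
        by simp
    qed
    finally show ?thesis
      by simp
  qed
  have "(\<lambda>k. (real d * (real k * (3/4) ^ k) + (3/4) ^ k) * (M * C)) \<longlonglongrightarrow> (real d * 0 + 0) * (M * C)"
    by (intro tendsto_intros powser_times_n_limit_0 LIMSEQ_realpow_zero) auto
  then have "(\<lambda>k. real (Suc (k * d)) * ((3/4) ^ k * (M * C))) \<longlonglongrightarrow> 0"
    by (simp add: algebra_simps)
  then have "1 \<le> (0::real)"
    by (rule tendsto_lowerbound) (use key in auto)
  then show False by simp
qed

end

section \<open>Cauchy-type determinants\<close>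

text \<open>
  Gaussian elimination in one step, as a factorisation of the matrix into a block upper triangular
  and a unipotent block lower triangular factor.
\<close>

lemma det_last_pivot:
  fixes f :: "nat \<Rightarrow> nat \<Rightarrow> 'a::field"
  assumes "f n n \<noteq> 0"
  shows "Determinant.det (mat (Suc n) (Suc n) (\<lambda>(i, j). f i j))
    = f n n * Determinant.det (mat n n (\<lambda>(i, j). f i j - f i n * f n j / f n n))"
proof -
  let ?A = "mat n n (\<lambda>(i, j). f i j - f i n * f n j / f n n)"
  let ?B = "mat n 1 (\<lambda>(i, j). f i n)"
  let ?D = "mat 1 1 (\<lambda>(i, j). f n n)"
  let ?C = "mat 1 n (\<lambda>(i, j). f n j / f n n)"
  let ?L = "four_block_mat ?A ?B (0\<^sub>m 1 n) ?D"
  let ?R = "four_block_mat (1\<^sub>m n) (0\<^sub>m n 1) ?C (1\<^sub>m 1)"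
  have "?L * ?R = four_block_mat (?A * 1\<^sub>m n + ?B * ?C) (?A * 0\<^sub>m n 1 + ?B * 1\<^sub>m 1)
      (0\<^sub>m 1 n * 1\<^sub>m n + ?D * ?C) (0\<^sub>m 1 n * 0\<^sub>m n 1 + ?D * 1\<^sub>m 1)"
    by (rule mult_four_block_mat) auto
  also have "\<dots> = mat (Suc n) (Suc n) (\<lambda>(i, j). f i j)"
    using assms by (intro eq_matI) (auto simp: scalar_prod_def less_Suc_eq)
  finally have "Determinant.det (mat (Suc n) (Suc n) (\<lambda>(i, j). f i j)) = Determinant.det (?L * ?R)"
    by simp
  also have "\<dots> = Determinant.det ?L * Determinant.det ?R"
    by (rule det_mult[of _ "n + 1"]) (auto intro!: four_block_carrier_mat)
  also have "Determinant.det ?L = Determinant.det ?A * Determinant.det ?D"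
    by (rule det_four_block_mat_lower_left_zero) auto
  also have "Determinant.det ?R = Determinant.det (1\<^sub>m n :: 'a mat) * Determinant.det (1\<^sub>m 1 :: 'a mat)"
    by (rule det_four_block_mat_upper_right_zero) auto
  also have "Determinant.det ?D = f n n"
    by (subst det_single) auto
  finally show ?thesis
    by simp
qed

lemma det_scale_rows_cols:
  fixes f :: "nat \<Rightarrow> nat \<Rightarrow> 'a::comm_ring_1"
  shows "Determinant.det (mat n n (\<lambda>(i, j). r i * c j * f i j))
    = (\<Prod>i<n. r i) * (\<Prod>j<n. c j) * Determinant.det (mat n n (\<lambda>(i, j). f i j))"
proof -
  have "(\<Prod>i = 0..<n. r i * c (\<pi> i) * f i (\<pi> i))
      = (\<Prod>i<n. r i) * (\<Prod>j<n. c j) * (\<Prod>i = 0..<n. f i (\<pi> i))"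
    if "\<pi> permutes {0..<n}" for \<pi>
    using prod.permute[OF that, of c] by (simp add: prod.distrib atLeast0LessThan o_def)
  then show ?thesis
    by (auto simp: Determinant.det_def sum_distrib_left mult_ac permutes_in_image intro!: sum.cong)
qed

text \<open>
  The Schur complement of the last entry is again of Cauchy type up to row and column factors,
  because \<open>(1 - a\<^sub>i b\<^sub>n)(1 - a\<^sub>n b\<^sub>j) - (1 - a\<^sub>n b\<^sub>n)(1 - a\<^sub>i b\<^sub>j) = (a\<^sub>i - a\<^sub>n)(b\<^sub>j - b\<^sub>n)\<close>.
\<close>

lemma cauchy_det_step:
  fixes a b :: "nat \<Rightarrow> 'a::field"
  assumes "\<And>i j. i \<le> n \<Longrightarrow> j \<le> n \<Longrightarrow> a i * b j \<noteq> 1"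
  shows "Determinant.det (mat (Suc n) (Suc n) (\<lambda>(i, j). 1 / (1 - a i * b j)))
    = 1 / (1 - a n * b n) * (\<Prod>j<n. (a j - a n) / (1 - a j * b n) * ((b j - b n) / (1 - a n * b j)))
      * Determinant.det (mat n n (\<lambda>(i, j). 1 / (1 - a i * b j)))"
proof -
  have nz: "1 - a i * b j \<noteq> 0" if "i \<le> n" "j \<le> n" for i j
    using assms[OF that] by simp
  have entry: "1 / (1 - a i * b j) - 1 / (1 - a i * b n) * (1 / (1 - a n * b j)) / (1 / (1 - a n * b n))
      = (a i - a n) / (1 - a i * b n) * ((b j - b n) / (1 - a n * b j)) * (1 / (1 - a i * b j))"
    if "i < n" "j < n" for i j
    using nz[of i j] nz[of i n] nz[of n j] nz[of n n] that
    by (simp add: divide_simps) (simp add: algebra_simps)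
  have "Determinant.det (mat (Suc n) (Suc n) (\<lambda>(i, j). 1 / (1 - a i * b j)))
      = 1 / (1 - a n * b n) * Determinant.det (mat n n (\<lambda>(i, j). 1 / (1 - a i * b j)
        - 1 / (1 - a i * b n) * (1 / (1 - a n * b j)) / (1 / (1 - a n * b n))))"
    using nz[of n n] by (intro det_last_pivot) auto
  also have "mat n n (\<lambda>(i, j). 1 / (1 - a i * b j)
        - 1 / (1 - a i * b n) * (1 / (1 - a n * b j)) / (1 / (1 - a n * b n)))
      = mat n n (\<lambda>(i, j). (a i - a n) / (1 - a i * b n) * ((b j - b n) / (1 - a n * b j)) * (1 / (1 - a i * b j)))"
    using entry by (intro cong_mat) auto
  finally show ?thesis
    unfolding prod.distrib det_scale_rows_cols[of n "\<lambda>i. (a i - a n) / (1 - a i * b n)"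
        "\<lambda>j. (b j - b n) / (1 - a n * b j)" "\<lambda>i j. 1 / (1 - a i * b j)"]
    by (simp only: mult.assoc)
qed

lemma cauchy_det_nonzero:
  fixes a b :: "nat \<Rightarrow> 'a::field"
  assumes "\<And>i j. i < n \<Longrightarrow> j < n \<Longrightarrow> a i * b j \<noteq> 1"
    and "inj_on a {..<n}" and "inj_on b {..<n}"
  shows "Determinant.det (mat n n (\<lambda>(i, j). 1 / (1 - a i * b j))) \<noteq> 0"
  using assms
proof (induction n)
  case 0
  then show ?case by simp
next
  case (Suc n)
  have "Determinant.det (mat n n (\<lambda>(i, j). 1 / (1 - a i * b j))) \<noteq> 0"
    using Suc.prems by (intro Suc.IH) (auto simp: inj_on_def)
  moreover have "a j \<noteq> a n" "b j \<noteq> b n" if "j < n" for j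
    using Suc.prems(2,3) that by (auto simp: inj_on_def)
  moreover have "1 - a i * b j \<noteq> 0" if "i < Suc n" "j < Suc n" for i j
    using Suc.prems(1)[OF that] by simp
  ultimately show ?case
    using Suc.prems(1) by (subst cauchy_det_step) auto
qed

section \<open>Uniform limits\<close>

lemma uniform_limit_prod_bounded:
  fixes f :: "'a \<Rightarrow> 'b \<Rightarrow> 'i \<Rightarrow> 'c::real_normed_field"
  assumes "finite I"
    and "\<And>i. i \<in> I \<Longrightarrow> uniform_limit X (\<lambda>n x. f n x i) (\<lambda>x. l x i) F"
    and "\<And>i. i \<in> I \<Longrightarrow> bounded ((\<lambda>x. l x i) ` X)"
  shows "uniform_limit X (\<lambda>n x. \<Prod>i\<in>I. f n x i) (\<lambda>x. \<Prod>i\<in>I. l x i) F"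
proof -
  \<comment> \<open>Boundedness of the partial products is carried along: the product rule for uniform limits
      needs it for both factors.\<close>
  have "uniform_limit X (\<lambda>n x. \<Prod>i\<in>I. f n x i) (\<lambda>x. \<Prod>i\<in>I. l x i) F
      \<and> bounded ((\<lambda>x. \<Prod>i\<in>I. l x i) ` X)"
    using assms
  proof (induction I rule: finite_induct)
    case empty
    then show ?case
      by (auto simp: uniform_limit_const image_constant_conv)
  next
    case (insert i I)
    then obtain B C where "\<And>x. x \<in> X \<Longrightarrow> norm (l x i) \<le> B" "\<And>x. x \<in> X \<Longrightarrow> norm (\<Prod>i\<in>I. l x i) \<le> C"
      unfolding bounded_iff by (metis imageI insertI1 insertI2)
    then have "norm (l x i * (\<Prod>i\<in>I. l x i)) \<le> B * C" if "x \<in> X" for x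
      using that unfolding norm_mult by (meson mult_mono norm_ge_zero order_trans)
    then have "bounded ((\<lambda>x. l x i * (\<Prod>i\<in>I. l x i)) ` X)"
      unfolding bounded_iff by blast
    with insert show ?case
      by (auto intro!: uniform_lim_mult)
  qed
  then show ?thesis ..
qed

lemma uniform_limit_finite_sum:
  fixes f :: "'a \<Rightarrow> 'b \<Rightarrow> 'i \<Rightarrow> 'c::real_normed_vector"
  assumes "\<And>i. i \<in> I \<Longrightarrow> uniform_limit X (\<lambda>n x. f n x i) (\<lambda>x. l x i) F"
  shows "uniform_limit X (\<lambda>n x. \<Sum>i\<in>I. f n x i) (\<lambda>x. \<Sum>i\<in>I. l x i) F"
  using assms
  by (induction I rule: infinite_finite_induct) (auto intro!: uniform_limit_intros)

lemma uniform_limit_det: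
  fixes f :: "'a \<Rightarrow> 'b \<Rightarrow> nat \<Rightarrow> nat \<Rightarrow> complex"
  assumes "\<And>i j. i < m \<Longrightarrow> j < m \<Longrightarrow> uniform_limit X (\<lambda>n x. f n x i j) (\<lambda>x. l x i j) F"
    and "\<And>i j. i < m \<Longrightarrow> j < m \<Longrightarrow> bounded ((\<lambda>x. l x i j) ` X)"
  shows "uniform_limit X (\<lambda>n x. Determinant.det (mat m m (\<lambda>(i, j). f n x i j)))
    (\<lambda>x. Determinant.det (mat m m (\<lambda>(i, j). l x i j))) F"
proof -
  have leib: "Determinant.det (mat m m (\<lambda>(i, j). h i j))
      = (\<Sum>\<pi>\<in>{\<pi>. \<pi> permutes {0..<m}}. signof \<pi> * (\<Prod>i\<in>{0..<m}. h i (\<pi> i)))" for h :: "nat \<Rightarrow> nat \<Rightarrow> complex"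
    by (auto simp: Determinant.det_def permutes_in_image intro!: sum.cong)
  show ?thesis
    unfolding leib
    by (intro uniform_limit_finite_sum
        bounded_linear.uniform_limit[OF bounded_linear_mult_right] uniform_limit_prod_bounded)
      (use assms in \<open>auto simp: permutes_in_image\<close>)
qed

text \<open>
  The limit \<open>L = 1 / (1 - a)\<close> is the fixed point of \<open>L = 1 + a L\<close>, and the error satisfies
  \<open>S\<^sub>n\<^sub>+\<^sub>1 - L = r\<^sub>n (S\<^sub>n - L) + (r\<^sub>n - a) L\<close>: a contraction with a uniformly vanishing perturbation.
  The hypothesis \<open>bdd\<close> makes the initial error of the contraction uniform on \<open>X\<close>.
\<close>

lemma uniform_limit_affine_recursion:
  fixes S r :: "nat \<Rightarrow> 'b \<Rightarrow> complex" and a :: "'b \<Rightarrow> complex"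
  assumes lim: "uniform_limit X r a sequentially"
    and q: "q < 1" "\<And>x. x \<in> X \<Longrightarrow> cmod (a x) \<le> q"
    and rec: "\<forall>\<^sub>F n in sequentially. \<forall>x\<in>X. S (Suc n) x = 1 + r n x * S n x"
    and bdd: "\<forall>\<^sub>F n in sequentially. bounded (S n ` X)"
  shows "uniform_limit X S (\<lambda>x. 1 / (1 - a x)) sequentially"
proof (cases "X = {}")
  case False
  then have "0 \<le> q"
    using q(2) norm_ge_zero order_trans by blast
  define s where "s = (1 + q) / 2"
  have s: "0 < s" "s < 1" "q < s"
    using q(1) \<open>0 \<le> q\<close> by (auto simp: s_def)
  define L where "L x = 1 / (1 - a x)" for x
  have one_minus: "1 - q \<le> cmod (1 - a x)" if "x \<in> X" for x
    using norm_triangle_ineq2[of 1 "a x"] q(2)[OF that] by simp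
  have L: "L x = 1 + a x * L x" "cmod (L x) \<le> 1 / (1 - q)" if "x \<in> X" for x
  proof -
    have "1 - a x \<noteq> 0"
      using one_minus[OF that] q(1) by auto
    then show "L x = 1 + a x * L x"
      by (simp add: L_def field_simps)
    show "cmod (L x) \<le> 1 / (1 - q)"
      using one_minus[OF that] q(1) by (simp add: L_def norm_divide frac_le)
  qed
  show ?thesis
    unfolding L_def[symmetric]
  proof (rule uniform_limitI)
    fix e :: real assume "0 < e"
    \<comment> \<open>A perturbation of size \<open>e / 2 * (1 - s)\<close> per step accumulates to at most
        \<open>e / 2\<close> under contraction by \<open>s\<close>; the factor \<open>1 - q\<close> absorbs the bound on \<open>L\<close>.\<close>
    define \<delta> where "\<delta> = e / 2 * (1 - s) * (1 - q)"
    have "0 < \<delta>"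
      using \<open>0 < e\<close> s q(1) by (simp add: \<delta>_def)
    have "\<forall>\<^sub>F n in sequentially. (\<forall>x\<in>X. dist (r n x) (a x) < \<delta>) \<and>
        (\<forall>x\<in>X. dist (r n x) (a x) < s - q) \<and>
        (\<forall>x\<in>X. S (Suc n) x = 1 + r n x * S n x) \<and> bounded (S n ` X)"
      using \<open>0 < \<delta>\<close> s(3) by (intro eventually_conj uniform_limitD[OF lim] rec bdd) auto
    then obtain N where N: "\<And>n x. n \<ge> N \<Longrightarrow> x \<in> X \<Longrightarrow> cmod (r n x - a x) < \<delta>"
        "\<And>n x. n \<ge> N \<Longrightarrow> x \<in> X \<Longrightarrow> cmod (r n x - a x) < s - q"
        "\<And>n x. n \<ge> N \<Longrightarrow> x \<in> X \<Longrightarrow> S (Suc n) x = 1 + r n x * S n x"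
        "bounded (S N ` X)"
      unfolding eventually_sequentially dist_norm by blast
    obtain B where B: "\<And>x. x \<in> X \<Longrightarrow> cmod (S N x) \<le> B"
      using N(4) unfolding bounded_iff by auto
    define D where "D = B + 1 / (1 - q)"
    have step: "cmod (S (Suc n) x - L x) \<le> s * cmod (S n x - L x) + e / 2 * (1 - s)"
      if "n \<ge> N" "x \<in> X" for n x
    proof -
      have "S (Suc n) x - L x = r n x * (S n x - L x) + (r n x - a x) * L x"
        using N(3)[OF that] L(1)[OF that(2)] by (simp add: algebra_simps)
      then have "cmod (S (Suc n) x - L x)
          \<le> cmod (r n x) * cmod (S n x - L x) + cmod (r n x - a x) * cmod (L x)"
        by (metis norm_mult norm_triangle_ineq)
      moreover have "cmod (r n x) \<le> s"
        using norm_triangle_ineq[of "r n x - a x" "a x"] N(2)[OF that] q(2)[OF that(2)] by simp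
      then have "cmod (r n x) * cmod (S n x - L x) \<le> s * cmod (S n x - L x)"
        by (intro mult_right_mono) auto
      moreover have "cmod (r n x - a x) * cmod (L x) \<le> \<delta> * (1 / (1 - q))"
        using N(1)[OF that] L(2)[OF that(2)] \<open>0 < \<delta>\<close> by (intro mult_mono) auto
      moreover have "\<delta> * (1 / (1 - q)) = e / 2 * (1 - s)"
        using q(1) by (simp add: \<delta>_def divide_simps)
      ultimately show ?thesis
        by linarith
    qed
    have iter: "cmod (S (N + k) x - L x) \<le> s ^ k * D + e / 2" if "x \<in> X" for k x
    proof (induction k)
      case 0
      show ?case
        using norm_triangle_ineq4[of "S N x" "L x"] B[OF that] L(2)[OF that] \<open>0 < e\<close>
        by (simp add: D_def)
    next
      case (Suc k)
      have "cmod (S (N + Suc k) x - L x) \<le> s * cmod (S (N + k) x - L x) + e / 2 * (1 - s)"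
        using step[of "N + k" x] that by simp
      also have "\<dots> \<le> s * (s ^ k * D + e / 2) + e / 2 * (1 - s)"
        using Suc s(1) by simp
      also have "\<dots> = s ^ Suc k * D + e / 2"
        by (simp add: field_simps)
      finally show ?case .
    qed
    have "(\<lambda>k. s ^ k * D) \<longlonglongrightarrow> 0 * D"
      using s by (intro tendsto_intros LIMSEQ_realpow_zero) auto
    then have "\<forall>\<^sub>F k in sequentially. s ^ k * D < e / 2"
      using \<open>0 < e\<close> by (intro order_tendstoD(2)[of _ "0 * D"]) auto
    then obtain K where K: "\<And>k. k \<ge> K \<Longrightarrow> s ^ k * D < e / 2"
      unfolding eventually_sequentially by blast
    have "dist (S n x) (L x) < e" if "n \<ge> N + K" "x \<in> X" for n x
    proof -
      have "cmod (S n x - L x) \<le> s ^ (n - N) * D + e / 2"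
        using iter[OF that(2), of "n - N"] that(1) by simp
      moreover have "s ^ (n - N) * D < e / 2"
        using that(1) by (intro K) simp
      ultimately show ?thesis
        unfolding dist_norm by linarith
    qed
    then show "\<forall>\<^sub>F n in sequentially. \<forall>x\<in>X. dist (S n x) (L x) < e"
      unfolding eventually_sequentially by blast
  qed
qed simp

section \<open>Kernels of sequences with ratio asymptotics\<close>

text \<open>
  The asymptotics of the kernels are determined by the ratios of consecutive functions alone, so
  they are derived for arbitrary sequences. The set \<open>X\<close> is compact so that all bounds are uniform; it will
  be instantiated by the given compact set together with the fixed nodes of the determinants.
\<close>

locale ratio_asymptotics =
  fixes X :: "'a::topological_space set" and p :: "nat \<Rightarrow> 'a \<Rightarrow> complex" and g :: "'a \<Rightarrow> complex"
  assumes compact_X: "compact X"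
    and cont_p: "\<And>n. continuous_on X (p n)"
    and cont_g: "continuous_on X g"
    and g_nonzero: "\<And>x. x \<in> X \<Longrightarrow> g x \<noteq> 0"
    and g_less_one: "\<And>x. x \<in> X \<Longrightarrow> cmod (g x) < 1"
    and ratio_lim: "uniform_limit X (\<lambda>n x. p n x / p (Suc n) x) g sequentially"
begin

definition kernel :: "nat \<Rightarrow> 'a \<Rightarrow> 'a \<Rightarrow> complex" where
  "kernel n x y = (\<Sum>j\<le>n. p j x * cnj (p j y))"

definition cosine :: "nat \<Rightarrow> 'a \<Rightarrow> 'a \<Rightarrow> complex" where
  "cosine n x y = kernel n x y / (csqrt (kernel n x x) * csqrt (kernel n y y))"

text \<open>
  The unimodular factors cancel the arguments of \<open>p n x\<close> and \<open>p n y\<close>, which need not converge.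
\<close>

definition phased_cosine :: "nat \<Rightarrow> 'a \<Rightarrow> 'a \<Rightarrow> complex" where
  "phased_cosine n x y = cosine n x y * (complex_of_real (cmod (p n x)) / p n x)
     * (p n y / complex_of_real (cmod (p n y)))"

definition cosine_limit :: "'a \<Rightarrow> 'a \<Rightarrow> complex" where
  "cosine_limit x y = complex_of_real (sqrt ((1 - (cmod (g x))\<^sup>2) * (1 - (cmod (g y))\<^sup>2)))
     / (1 - g x * cnj (g y))"

lemma g_bounds:
  obtains c \<rho> where "0 < c" "0 < \<rho>" "\<rho> < 1" "\<And>x. x \<in> X \<Longrightarrow> c \<le> cmod (g x)" "\<And>x. x \<in> X \<Longrightarrow> cmod (g x) \<le> \<rho>"
proof (cases "X = {}")
  case True
  then show ?thesis
    using that[of 1 "1/2"] by auto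
next
  case False
  have cont: "continuous_on X (\<lambda>x. cmod (g x))"
    by (intro continuous_intros cont_g)
  obtain x where x: "x \<in> X" "\<And>y. y \<in> X \<Longrightarrow> cmod (g x) \<le> cmod (g y)"
    using continuous_attains_inf[OF compact_X False cont] by blast
  obtain y where y: "y \<in> X" "\<And>x. x \<in> X \<Longrightarrow> cmod (g x) \<le> cmod (g y)"
    using continuous_attains_sup[OF compact_X False cont] by blast
  show ?thesis
    using that[of "cmod (g x)" "cmod (g y)"] x y g_nonzero g_less_one by auto
qed

text \<open>
  Division by zero yields zero, so a vanishing \<open>p n x\<close> would make the ratio 0, whereas \<open>g\<close> is
  bounded away from 0 on \<open>X\<close>.
\<close>

lemma eventually_p_nonzero: "\<forall>\<^sub>F n in sequentially. \<forall>x\<in>X. p n x \<noteq> 0"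
proof -
  obtain c \<rho> where c: "0 < c" "\<And>x. x \<in> X \<Longrightarrow> c \<le> cmod (g x)"
    by (rule g_bounds) blast
  from uniform_limitD[OF ratio_lim c(1)]
  show ?thesis
  proof (rule eventually_mono)
    fix n assume n: "\<forall>x\<in>X. dist (p n x / p (Suc n) x) (g x) < c"
    show "\<forall>x\<in>X. p n x \<noteq> 0"
    proof
      fix x assume "x \<in> X"
      then show "p n x \<noteq> 0"
        using n[rule_format, of x] c(2)[of x] by (auto simp: dist_norm)
    qed
  qed
qed

lemma p_bounded_below:
  assumes "\<forall>x\<in>X. p n x \<noteq> 0"
  obtains \<delta> where "0 < \<delta>" "\<And>x. x \<in> X \<Longrightarrow> \<delta> \<le> cmod (p n x)"
proof (cases "X = {}")
  case True
  then show ?thesis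
    using that[of 1] by auto
next
  case False
  have cont: "continuous_on X (\<lambda>x. cmod (p n x))"
    by (intro continuous_intros cont_p)
  obtain x where x: "x \<in> X" "\<And>y. y \<in> X \<Longrightarrow> cmod (p n x) \<le> cmod (p n y)"
    using continuous_attains_inf[OF compact_X False cont] by blast
  then show ?thesis
    using that[of "cmod (p n x)"] assms by auto
qed

lemma kernel_diag: "kernel n x x = complex_of_real (\<Sum>j\<le>n. (cmod (p j x))\<^sup>2)"
  by (simp only: kernel_def of_real_sum complex_norm_square)

text \<open>
  Eventually \<open>|p\<^sub>n / p\<^sub>n\<^sub>+\<^sub>1| \<le> s < 1\<close> on \<open>X\<close>, hence \<open>1 / |p\<^sub>n|\<close> decays geometrically.
\<close>

lemma inverse_p_limit: "uniform_limit X (\<lambda>n x. 1 / cmod (p n x)) (\<lambda>x. 0) sequentially"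
proof (rule uniform_limitI)
  fix e :: real assume "0 < e"
  obtain c \<rho> where c: "0 < c" "0 < \<rho>" "\<rho> < 1" "\<And>x. x \<in> X \<Longrightarrow> c \<le> cmod (g x)"
      "\<And>x. x \<in> X \<Longrightarrow> cmod (g x) \<le> \<rho>"
    using g_bounds by blast
  define s where "s = (1 + \<rho>) / 2"
  have s: "0 < s" "s < 1" "\<rho> < s"
    using c by (auto simp: s_def)
  have "\<forall>\<^sub>F n in sequentially. (\<forall>x\<in>X. dist (p n x / p (Suc n) x) (g x) < s - \<rho>) \<and> (\<forall>x\<in>X. p n x \<noteq> 0)"
    using s by (intro eventually_conj uniform_limitD[OF ratio_lim] eventually_p_nonzero) auto
  then obtain N where N: "\<And>n x. n \<ge> N \<Longrightarrow> x \<in> X \<Longrightarrow> dist (p n x / p (Suc n) x) (g x) < s - \<rho>"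
      "\<And>n x. n \<ge> N \<Longrightarrow> x \<in> X \<Longrightarrow> p n x \<noteq> 0"
    unfolding eventually_sequentially by blast
  obtain \<delta> where \<delta>: "0 < \<delta>" "\<And>x. x \<in> X \<Longrightarrow> \<delta> \<le> cmod (p N x)"
    using p_bounded_below[of N] N(2) by blast
  have iter: "1 / cmod (p (N + k) x) \<le> s ^ k * (1 / \<delta>)" if "x \<in> X" for k x
  proof (induction k)
    case 0
    show ?case
      using \<delta> that by (simp add: frac_le)
  next
    case (Suc k)
    let ?r = "p (N + k) x / p (Suc (N + k)) x"
    have "cmod ?r \<le> s"
      using norm_triangle_ineq[of "?r - g x" "g x"] N(1)[of "N + k" x] c(5)[OF that] that
      by (simp add: dist_norm)
    moreover have "1 / cmod (p (N + Suc k) x) = cmod ?r * (1 / cmod (p (N + k) x))"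
      using N(2)[of "N + k" x] that by (simp add: norm_divide)
    ultimately have "1 / cmod (p (N + Suc k) x) \<le> s * (s ^ k * (1 / \<delta>))"
      using Suc s(1) by (simp only:) (intro mult_mono, auto)
    then show ?case
      by simp
  qed
  have "(\<lambda>k. s ^ k * (1 / \<delta>)) \<longlonglongrightarrow> 0 * (1 / \<delta>)"
    using s by (intro tendsto_intros LIMSEQ_realpow_zero) auto
  then have "\<forall>\<^sub>F k in sequentially. s ^ k * (1 / \<delta>) < e"
    using \<open>0 < e\<close> by (intro order_tendstoD(2)[of _ "0 * (1 / \<delta>)"]) auto
  then obtain K where K: "\<And>k. k \<ge> K \<Longrightarrow> s ^ k * (1 / \<delta>) < e"
    unfolding eventually_sequentially by blast
  have "dist (1 / cmod (p n x)) 0 < e" if "n \<ge> N + K" "x \<in> X" for n x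
  proof -
    have "1 / cmod (p n x) \<le> s ^ (n - N) * (1 / \<delta>)"
      using iter[OF that(2), of "n - N"] that(1) by simp
    also have "\<dots> < e"
      using that(1) by (intro K) simp
    finally show ?thesis
      by simp
  qed
  then show "\<forall>\<^sub>F n in sequentially. \<forall>x\<in>X. dist (1 / cmod (p n x)) 0 < e"
    unfolding eventually_sequentially by blast
qed

lemma inverse_kernel_limit: "uniform_limit X (\<lambda>n x. 1 / kernel n x x) (\<lambda>x. 0) sequentially"
proof (rule uniform_limit_null_comparison)
  have "uniform_limit X (\<lambda>n x. 1 / cmod (p n x) * (1 / cmod (p n x))) (\<lambda>x. 0 * 0) sequentially"
    by (intro uniform_lim_mult inverse_p_limit) (auto simp: image_constant_conv)
  then show "uniform_limit X (\<lambda>n x. 1 / cmod (p n x) * (1 / cmod (p n x))) (\<lambda>x. 0) sequentially"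
    by simp
  show "\<forall>\<^sub>F n in sequentially. \<forall>x\<in>X. cmod (1 / kernel n x x) \<le> 1 / cmod (p n x) * (1 / cmod (p n x))"
    using eventually_p_nonzero
  proof (rule eventually_mono, intro ballI)
    fix n x assume "\<forall>x\<in>X. p n x \<noteq> 0" "x \<in> X"
    then have "0 < (cmod (p n x))\<^sup>2"
      by simp
    moreover have "(cmod (p n x))\<^sup>2 \<le> (\<Sum>j\<le>n. (cmod (p j x))\<^sup>2)"
      by (intro member_le_sum) auto
    ultimately show "cmod (1 / kernel n x x) \<le> 1 / cmod (p n x) * (1 / cmod (p n x))"
      by (simp only: kernel_diag norm_divide norm_of_real) (simp add: frac_le power2_eq_square)
  qed
qed

lemma kernel_ratio_limit:
  "uniform_limit (X \<times> X) (\<lambda>n (x, y). kernel n x y / (p n x * cnj (p n y)))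
    (\<lambda>(x, y). 1 / (1 - g x * cnj (g y))) sequentially"
proof -
  obtain \<rho> where \<rho>: "0 < \<rho>" "\<rho> < 1" "\<And>x. x \<in> X \<Longrightarrow> cmod (g x) \<le> \<rho>"
    by (rule g_bounds) blast
  have fst: "uniform_limit (X \<times> X) (\<lambda>n u. p n (fst u) / p (Suc n) (fst u)) (\<lambda>u. g (fst u)) sequentially"
    by (rule uniform_limit_compose'[OF ratio_lim]) auto
  have snd: "uniform_limit (X \<times> X) (\<lambda>n u. p n (snd u) / p (Suc n) (snd u)) (\<lambda>u. g (snd u)) sequentially"
    by (rule uniform_limit_compose'[OF ratio_lim]) auto
  have "uniform_limit (X \<times> X) (\<lambda>n u. p n (fst u) / p (Suc n) (fst u) * cnj (p n (snd u) / p (Suc n) (snd u)))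
      (\<lambda>u. g (fst u) * cnj (g (snd u))) sequentially"
    by (intro uniform_lim_mult fst bounded_linear.uniform_limit[OF bounded_linear_cnj] snd)
      (auto simp: bounded_iff intro!: exI[of _ \<rho>] \<rho>)
  moreover have "cmod (g (fst u) * cnj (g (snd u))) \<le> \<rho> * \<rho>" if "u \<in> X \<times> X" for u
    using that \<rho> by (auto simp: norm_mult intro!: mult_mono)
  moreover have "\<rho> * \<rho> < 1"
    using \<rho> mult_strict_mono[of \<rho> 1 \<rho> 1] by simp
  moreover have "\<forall>\<^sub>F n in sequentially. \<forall>u\<in>X \<times> X.
      kernel (Suc n) (fst u) (snd u) / (p (Suc n) (fst u) * cnj (p (Suc n) (snd u)))
      = 1 + p n (fst u) / p (Suc n) (fst u) * cnj (p n (snd u) / p (Suc n) (snd u))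
        * (kernel n (fst u) (snd u) / (p n (fst u) * cnj (p n (snd u))))"
    using eventually_p_nonzero eventually_sequentially_Suc[THEN iffD2, OF eventually_p_nonzero]
  proof (eventually_elim, intro ballI)
    fix n u assume "\<forall>x\<in>X. p n x \<noteq> 0" "\<forall>x\<in>X. p (Suc n) x \<noteq> 0" "u \<in> X \<times> X"
    then have "p n (fst u) \<noteq> 0" "p n (snd u) \<noteq> 0" "p (Suc n) (fst u) \<noteq> 0" "p (Suc n) (snd u) \<noteq> 0"
      by auto
    then show "kernel (Suc n) (fst u) (snd u) / (p (Suc n) (fst u) * cnj (p (Suc n) (snd u)))
      = 1 + p n (fst u) / p (Suc n) (fst u) * cnj (p n (snd u) / p (Suc n) (snd u))
        * (kernel n (fst u) (snd u) / (p n (fst u) * cnj (p n (snd u))))"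
      by (simp add: kernel_def field_simps)
  qed
  moreover have "\<forall>\<^sub>F n in sequentially.
      bounded ((\<lambda>u. kernel n (fst u) (snd u) / (p n (fst u) * cnj (p n (snd u)))) ` (X \<times> X))"
    using eventually_p_nonzero
  proof (rule eventually_mono)
    fix n assume n: "\<forall>x\<in>X. p n x \<noteq> 0"
    have "continuous_on (X \<times> X) (\<lambda>u. p j (fst u))" "continuous_on (X \<times> X) (\<lambda>u. p j (snd u))" for j
      by (rule continuous_on_compose2[OF cont_p]; auto intro!: continuous_intros)+
    then have "continuous_on (X \<times> X) (\<lambda>u. kernel n (fst u) (snd u) / (p n (fst u) * cnj (p n (snd u))))"
      unfolding kernel_def using n by (intro continuous_intros) auto
    then show "bounded ((\<lambda>u. kernel n (fst u) (snd u) / (p n (fst u) * cnj (p n (snd u)))) ` (X \<times> X))"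
      using compact_X by (intro compact_imp_bounded compact_continuous_image compact_Times)
  qed
  ultimately show ?thesis
    unfolding case_prod_beta by (intro uniform_limit_affine_recursion)
qed

text \<open>
  The reciprocal \<open>|p\<^sub>n(x)|\<^sup>2 / K\<^sub>n(x,x)\<close> of the normalised diagonal kernel always lies in \<open>[0, 1]\<close>,
  where the square root is uniformly continuous.
\<close>

lemma sqrt_kernel_limit:
  "uniform_limit X (\<lambda>n x. cmod (p n x) / sqrt (\<Sum>j\<le>n. (cmod (p j x))\<^sup>2))
    (\<lambda>x. sqrt (1 - (cmod (g x))\<^sup>2)) sequentially"
proof -
  let ?R = "\<lambda>n x. (\<Sum>j\<le>n. (cmod (p j x))\<^sup>2) / (cmod (p n x))\<^sup>2"
  have pos: "0 < 1 - (cmod (g x))\<^sup>2" if "x \<in> X" for x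
    using g_less_one[OF that] by (simp add: abs_square_less_1)
  have "uniform_limit X (\<lambda>n x. (\<lambda>(x, y). kernel n x y / (p n x * cnj (p n y))) (x, x))
      (\<lambda>x. (\<lambda>(x, y). 1 / (1 - g x * cnj (g y))) (x, x)) sequentially"
    by (rule uniform_limit_compose'[OF kernel_ratio_limit]) auto
  then have "uniform_limit X (\<lambda>n x. complex_of_real (?R n x)) (\<lambda>x. complex_of_real (1 / (1 - (cmod (g x))\<^sup>2))) sequentially"
    by (simp only: case_prod_conv kernel_diag complex_norm_square[symmetric] of_real_divide of_real_diff of_real_1)
  from bounded_linear.uniform_limit[OF bounded_linear_Re this]
  have "uniform_limit X ?R (\<lambda>x. 1 / (1 - (cmod (g x))\<^sup>2)) sequentially"
    by (simp only: Re_complex_of_real)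
  then have "uniform_limit X (\<lambda>n x. inverse (?R n x)) (inverse \<circ> (\<lambda>x. 1 / (1 - (cmod (g x))\<^sup>2))) sequentially"
  proof (rule uniform_lim_inverse[where b = 1])
    show "1 \<le> norm (1 / (1 - (cmod (g x))\<^sup>2))" if "x \<in> X" for x
      using pos[OF that] by (simp add: le_divide_eq)
  qed auto
  then have lim: "uniform_limit X (\<lambda>n x. inverse (?R n x)) (\<lambda>x. 1 - (cmod (g x))\<^sup>2) sequentially"
    by (simp add: o_def)
  have "uniform_limit X (\<lambda>n x. sqrt (inverse (?R n x))) (\<lambda>x. sqrt (1 - (cmod (g x))\<^sup>2)) sequentially"
  proof (rule uniform_limit_compose_uniformly_continuous_on[OF lim])
    show "uniformly_continuous_on {0..1::real} sqrt"
      by (intro compact_uniformly_continuous continuous_intros compact_Icc)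
    show "\<forall>\<^sub>F n in sequentially. \<forall>x\<in>X. inverse (?R n x) \<in> {0..1}"
    proof (rule always_eventually, intro allI ballI)
      fix n x
      have "(cmod (p n x))\<^sup>2 \<le> (\<Sum>j\<le>n. (cmod (p j x))\<^sup>2)"
        by (intro member_le_sum) auto
      moreover have "0 \<le> (\<Sum>j\<le>n. (cmod (p j x))\<^sup>2)"
        by (simp add: sum_nonneg)
      ultimately show "inverse (?R n x) \<in> {0..1}"
        by (simp add: divide_le_eq_1 less_le)
    qed
  qed simp
  then show ?thesis
    by (simp add: real_sqrt_divide)
qed

lemma phased_cosine_eq:
  assumes "p n x \<noteq> 0" "p n y \<noteq> 0"
  shows "phased_cosine n x y = kernel n x y / (p n x * cnj (p n y))
    * (complex_of_real (cmod (p n x) / sqrt (\<Sum>j\<le>n. (cmod (p j x))\<^sup>2))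
      * complex_of_real (cmod (p n y) / sqrt (\<Sum>j\<le>n. (cmod (p j y))\<^sup>2)))"
proof -
  have sq: "csqrt (kernel n z z) = complex_of_real (sqrt (\<Sum>j\<le>n. (cmod (p j z))\<^sup>2))" for z
    unfolding kernel_diag by (subst csqrt_of_real_nonneg) (simp_all add: sum_nonneg del: of_real_sum)
  have y: "p n y / complex_of_real (cmod (p n y)) = complex_of_real (cmod (p n y)) / cnj (p n y)"
    using assms(2) complex_norm_square[of "p n y"] by (simp add: field_simps power2_eq_square)
  show ?thesis
    unfolding phased_cosine_def cosine_def sq y by (simp add: field_simps)
qed

theorem phased_cosine_limit:
  "uniform_limit (X \<times> X) (\<lambda>n (x, y). phased_cosine n x y) (\<lambda>(x, y). cosine_limit x y) sequentially"
proof -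
  obtain \<rho> where \<rho>: "0 < \<rho>" "\<rho> < 1" "\<And>x. x \<in> X \<Longrightarrow> cmod (g x) \<le> \<rho>"
    by (rule g_bounds) blast
  let ?s = "\<lambda>x. complex_of_real (sqrt (1 - (cmod (g x))\<^sup>2))"
  let ?s' = "\<lambda>n x. complex_of_real (cmod (p n x) / sqrt (\<Sum>j\<le>n. (cmod (p j x))\<^sup>2))"
  have s: "uniform_limit X ?s' ?s sequentially"
    by (rule bounded_linear.uniform_limit[OF bounded_linear_of_real sqrt_kernel_limit])
  have s1: "uniform_limit (X \<times> X) (\<lambda>n u. ?s' n (fst u)) (\<lambda>u. ?s (fst u)) sequentially"
    by (rule uniform_limit_compose'[OF s]) auto
  have s2: "uniform_limit (X \<times> X) (\<lambda>n u. ?s' n (snd u)) (\<lambda>u. ?s (snd u)) sequentially"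
    by (rule uniform_limit_compose'[OF s]) auto
  have sb: "cmod (?s x) \<le> 1" if "x \<in> X" for x
    using g_less_one[OF that] by (simp add: abs_square_less_1 abs_square_le_1)
  have b1: "bounded ((\<lambda>u. ?s (fst u)) ` (X \<times> X))" "bounded ((\<lambda>u. ?s (snd u)) ` (X \<times> X))"
    unfolding bounded_iff using sb by force+
  have b2: "bounded ((\<lambda>u. ?s (fst u) * ?s (snd u)) ` (X \<times> X))"
    unfolding bounded_iff
  proof (intro exI ballI, elim imageE)
    fix u z assume u: "u \<in> X \<times> X" "z = ?s (fst u) * ?s (snd u)"
    then have "fst u \<in> X" "snd u \<in> X"
      by auto
    then show "cmod z \<le> 1"
      unfolding u(2) norm_mult by (intro mult_le_one norm_ge_zero sb)
  qed
  have b3: "bounded ((\<lambda>u. 1 / (1 - g (fst u) * cnj (g (snd u)))) ` (X \<times> X))"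
    unfolding bounded_iff
  proof (intro exI ballI, elim imageE)
    fix u z assume u: "u \<in> X \<times> X" "z = 1 / (1 - g (fst u) * cnj (g (snd u)))"
    have "cmod (g (fst u) * cnj (g (snd u))) \<le> \<rho> * 1"
      unfolding norm_mult using u(1) \<rho>(1,3) g_less_one by (intro mult_mono) (auto simp: less_imp_le)
    then have "1 - \<rho> \<le> cmod (1 - g (fst u) * cnj (g (snd u)))"
      using norm_triangle_ineq2[of 1 "g (fst u) * cnj (g (snd u))"] by simp
    then show "cmod z \<le> 1 / (1 - \<rho>)"
      using u(2) \<rho> by (simp add: norm_divide frac_le)
  qed
  have "uniform_limit (X \<times> X) (\<lambda>n u. kernel n (fst u) (snd u) / (p n (fst u) * cnj (p n (snd u)))
      * (?s' n (fst u) * ?s' n (snd u)))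
      (\<lambda>u. 1 / (1 - g (fst u) * cnj (g (snd u))) * (?s (fst u) * ?s (snd u))) sequentially"
    by (intro uniform_lim_mult s1 s2 b1 b2 b3 kernel_ratio_limit[unfolded case_prod_beta])
  also have "?this \<longleftrightarrow> ?thesis"
    unfolding case_prod_beta
  proof (rule uniform_limit_cong)
    show "\<forall>\<^sub>F n in sequentially. \<forall>u\<in>X \<times> X. kernel n (fst u) (snd u) / (p n (fst u) * cnj (p n (snd u)))
        * (?s' n (fst u) * ?s' n (snd u)) = phased_cosine n (fst u) (snd u)"
      using eventually_p_nonzero by eventually_elim (auto simp: phased_cosine_eq)
  qed (simp add: cosine_limit_def real_sqrt_mult)
  finally show ?thesis .
qed

lemma one_minus_g_nonzero: "x \<in> X \<Longrightarrow> y \<in> X \<Longrightarrow> g x * cnj (g y) \<noteq> 1"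
proof
  assume "x \<in> X" "y \<in> X" "g x * cnj (g y) = 1"
  then have "cmod (g x) * cmod (g y) = 1"
    by (metis complex_mod_cnj norm_mult norm_one)
  moreover have "cmod (g x) * cmod (g y) < 1 * 1"
    using g_less_one[OF \<open>x \<in> X\<close>] g_less_one[OF \<open>y \<in> X\<close>] by (intro mult_strict_mono') auto
  ultimately show False
    by simp
qed

lemma continuous_on_fst_snd:
  assumes "continuous_on X h"
  shows "continuous_on (X \<times> X) (\<lambda>u. h (fst u))" "continuous_on (X \<times> X) (\<lambda>u. h (snd u))"
  by (rule continuous_on_compose2[OF assms]; auto intro!: continuous_intros)+

lemma cosine_limit_bounded: "bounded ((\<lambda>u. cosine_limit (fst u) (snd u)) ` (X \<times> X))"
proof -
  have "1 - g (fst u) * cnj (g (snd u)) \<noteq> 0" if "u \<in> X \<times> X" for u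
    using one_minus_g_nonzero[of "fst u" "snd u"] that by auto
  then have "continuous_on (X \<times> X) (\<lambda>u. cosine_limit (fst u) (snd u))"
    unfolding cosine_limit_def by (intro continuous_intros continuous_on_fst_snd cont_g) auto
  then show ?thesis
    using compact_X by (intro compact_imp_bounded compact_continuous_image compact_Times)
qed

text \<open>
  The phase factors multiply rows and columns by numbers of modulus 1, so the convergent phased
  matrices may replace the original ones, whose entries need not converge.
\<close>

lemma cmod_det_phased_cosine:
  assumes "\<forall>x\<in>X. p n x \<noteq> 0" "\<And>i. i < m \<Longrightarrow> x i \<in> X" "\<And>i. i < m \<Longrightarrow> y i \<in> X"
  shows "cmod (Determinant.det (mat m m (\<lambda>(i, j). phased_cosine n (x i) (y j))))
    = cmod (Determinant.det (mat m m (\<lambda>(i, j). cosine n (x i) (y j))))"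
proof -
  let ?r = "\<lambda>i. complex_of_real (cmod (p n (x i))) / p n (x i)"
  let ?c = "\<lambda>j. p n (y j) / complex_of_real (cmod (p n (y j)))"
  have "mat m m (\<lambda>(i, j). phased_cosine n (x i) (y j))
      = mat m m (\<lambda>(i, j). ?r i * ?c j * cosine n (x i) (y j))"
    by (intro cong_mat) (auto simp: phased_cosine_def)
  moreover have "cmod (\<Prod>i<m. ?r i) = 1" "cmod (\<Prod>j<m. ?c j) = 1"
    using assms by (auto simp: prod_norm[symmetric] norm_divide intro!: prod.neutral)
  ultimately show ?thesis
    by (simp only: det_scale_rows_cols[of m ?r ?c "\<lambda>i j. cosine n (x i) (y j)"] norm_mult)
qed

lemma det_cosine_limit:
  "Determinant.det (mat m m (\<lambda>(i, j). cosine_limit (x i) (y j)))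
    = (\<Prod>i<m. complex_of_real (sqrt (1 - (cmod (g (x i)))\<^sup>2)))
      * (\<Prod>j<m. complex_of_real (sqrt (1 - (cmod (g (y j)))\<^sup>2)))
      * Determinant.det (mat m m (\<lambda>(i, j). 1 / (1 - g (x i) * cnj (g (y j)))))"
proof -
  have "mat m m (\<lambda>(i, j). cosine_limit (x i) (y j))
      = mat m m (\<lambda>(i, j). complex_of_real (sqrt (1 - (cmod (g (x i)))\<^sup>2))
        * complex_of_real (sqrt (1 - (cmod (g (y j)))\<^sup>2)) * (1 / (1 - g (x i) * cnj (g (y j)))))"
    by (intro cong_mat) (auto simp: cosine_limit_def real_sqrt_mult)
  then show ?thesis
    by (simp only: det_scale_rows_cols[of m "\<lambda>i. complex_of_real (sqrt (1 - (cmod (g (x i)))\<^sup>2))"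
        "\<lambda>j. complex_of_real (sqrt (1 - (cmod (g (y j)))\<^sup>2))" "\<lambda>i j. 1 / (1 - g (x i) * cnj (g (y j)))"])
qed

text \<open>
  Numerator and denominator converge separately, since determinants are polynomials in the entries;
  the limit of the denominator is nonzero because the nodes are distinct, and the quotient of the
  limits is computed by \<open>cauchy_det_step\<close>.
\<close>

theorem det_ratio_limit:
  assumes len: "length xs = l" "length ys = l" and sub: "set xs \<subseteq> X" "set ys \<subseteq> X"
    and dist: "distinct (map g xs)" "distinct (map g ys)"
  shows "uniform_limit (X \<times> X)
     (\<lambda>n (x, y). cmod (Determinant.det (mat (Suc l) (Suc l) (\<lambda>(i, j). cosine n ((xs @ [x]) ! i) ((ys @ [y]) ! j)))
        / Determinant.det (mat l l (\<lambda>(i, j). cosine n (xs ! i) (ys ! j)))))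
     (\<lambda>(x, y). sqrt ((1 - (cmod (g x))\<^sup>2) * (1 - (cmod (g y))\<^sup>2))
        / cmod (1 - g x * cnj (g y))
        * (\<Prod>j<l. cmod ((g y - g (ys ! j)) / (1 - g (xs ! j) * cnj (g y))
            * ((g x - g (xs ! j)) / (1 - g x * cnj (g (ys ! j)))))))
     sequentially"
proof -
  have mem: "xs ! i \<in> X" "ys ! i \<in> X" if "i < l" for i
    using that len subsetD[OF sub(1) nth_mem] subsetD[OF sub(2) nth_mem] by simp_all
  have mem': "(xs @ [x]) ! i \<in> X" "(ys @ [x]) ! i \<in> X" if "i < Suc l" "x \<in> X" for i x
    using that mem len by (auto simp: nth_append)
  define N where "N n u = Determinant.det (mat (Suc l) (Suc l)
    (\<lambda>(i, j). phased_cosine n ((xs @ [fst u]) ! i) ((ys @ [snd u]) ! j)))" for n u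
  define D where "D n = Determinant.det (mat l l (\<lambda>(i, j). phased_cosine n (xs ! i) (ys ! j)))" for n
  define N' where "N' u = Determinant.det (mat (Suc l) (Suc l)
    (\<lambda>(i, j). cosine_limit ((xs @ [fst u]) ! i) ((ys @ [snd u]) ! j)))" for u
  define D' where "D' = Determinant.det (mat l l (\<lambda>(i, j). cosine_limit (xs ! i) (ys ! j)))"
  \<comment> \<open>The quotient of the limits as a continuous function on \<open>X \<times> X\<close>; its boundedness is what the
      quotient rule for uniform limits needs.\<close>
  define R where "R u = complex_of_real (sqrt (1 - (cmod (g (fst u)))\<^sup>2)) * complex_of_real (sqrt (1 - (cmod (g (snd u)))\<^sup>2))
    * (1 / (1 - g (fst u) * cnj (g (snd u)))
      * (\<Prod>j<l. (g (xs ! j) - g (fst u)) / (1 - g (xs ! j) * cnj (g (snd u)))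
        * ((cnj (g (ys ! j)) - cnj (g (snd u))) / (1 - g (fst u) * cnj (g (ys ! j))))))" for u
  have nz: "1 - g x * cnj (g y) \<noteq> 0" if "x \<in> X" "y \<in> X" for x y
    using one_minus_g_nonzero[OF that] by simp
  have lim_entry: "uniform_limit (X \<times> X) (\<lambda>n u. phased_cosine n (h u) (k u)) (\<lambda>u. cosine_limit (h u) (k u)) sequentially"
    and bdd_entry: "bounded ((\<lambda>u. cosine_limit (h u) (k u)) ` (X \<times> X))"
    if "\<And>u. u \<in> X \<times> X \<Longrightarrow> h u \<in> X" "\<And>u. u \<in> X \<times> X \<Longrightarrow> k u \<in> X" for h k
  proof -
    show "uniform_limit (X \<times> X) (\<lambda>n u. phased_cosine n (h u) (k u)) (\<lambda>u. cosine_limit (h u) (k u)) sequentially"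
      using uniform_limit_compose'[OF phased_cosine_limit, of "\<lambda>u. (h u, k u)" "X \<times> X"] that by auto
    show "bounded ((\<lambda>u. cosine_limit (h u) (k u)) ` (X \<times> X))"
    proof (rule bounded_subset[OF cosine_limit_bounded], rule image_subsetI)
      fix u assume "u \<in> X \<times> X"
      then show "cosine_limit (h u) (k u) \<in> (\<lambda>u. cosine_limit (fst u) (snd u)) ` (X \<times> X)"
        using that by (intro image_eqI[of _ _ "(h u, k u)"]) auto
    qed
  qed
  have N_lim: "uniform_limit (X \<times> X) N N' sequentially"
    unfolding N_def N'_def by (intro uniform_limit_det lim_entry bdd_entry mem') auto
  have D_lim: "uniform_limit (X \<times> X) (\<lambda>n u. D n) (\<lambda>u. D') sequentially"
    unfolding D_def D'_def by (intro uniform_limit_det lim_entry bdd_entry mem) auto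
  have "D' \<noteq> 0"
  proof -
    have "Determinant.det (mat l l (\<lambda>(i, j). 1 / (1 - g (xs ! i) * cnj (g (ys ! j))))) \<noteq> 0"
    proof (rule cauchy_det_nonzero)
      show "g (xs ! i) * cnj (g (ys ! j)) \<noteq> 1" if "i < l" "j < l" for i j
        using one_minus_g_nonzero mem that by blast
      show "inj_on (\<lambda>i. g (xs ! i)) {..<l}" "inj_on (\<lambda>j. cnj (g (ys ! j))) {..<l}"
        using dist len by (auto simp: inj_on_def distinct_conv_nth)
    qed
    moreover have "1 - (cmod (g x))\<^sup>2 \<noteq> 0" if "x \<in> X" for x
      using g_less_one[OF that] abs_square_less_1[of "cmod (g x)"] by simp
    ultimately show ?thesis
      using mem by (auto simp: D'_def det_cosine_limit)
  qed
  have N'_eq: "N' u = D' * R u" if u: "u \<in> X \<times> X" for u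
  proof -
    let ?a = "\<lambda>i. g ((xs @ [fst u]) ! i)" and ?b = "\<lambda>j. cnj (g ((ys @ [snd u]) ! j))"
    have "?a i * ?b j \<noteq> 1" if "i \<le> l" "j \<le> l" for i j
      using that u by (intro one_minus_g_nonzero mem') auto
    from cauchy_det_step[of l ?a ?b, OF this]
    have "Determinant.det (mat (Suc l) (Suc l) (\<lambda>(i, j). 1 / (1 - ?a i * ?b j)))
      = 1 / (1 - ?a l * ?b l) * (\<Prod>j<l. (?a j - ?a l) / (1 - ?a j * ?b l) * ((?b j - ?b l) / (1 - ?a l * ?b j)))
      * Determinant.det (mat l l (\<lambda>(i, j). 1 / (1 - ?a i * ?b j)))" .
    also have "mat l l (\<lambda>(i, j). 1 / (1 - ?a i * ?b j)) = mat l l (\<lambda>(i, j). 1 / (1 - g (xs ! i) * cnj (g (ys ! j))))"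
      using len by (intro cong_mat) (auto simp: nth_append)
    finally show ?thesis
      using len by (simp add: N'_def D'_def R_def det_cosine_limit nth_append)
  qed
  have "continuous_on (X \<times> X) R"
    unfolding R_def by (intro continuous_intros continuous_on_fst_snd cont_g) (use nz mem in auto)
  then have "bounded (R ` (X \<times> X))"
    using compact_X by (intro compact_imp_bounded compact_continuous_image compact_Times)
  then obtain B where B: "\<And>u. u \<in> X \<times> X \<Longrightarrow> cmod (R u) \<le> B"
    unfolding bounded_iff by auto
  have "bounded (N' ` (X \<times> X))"
    unfolding bounded_iff
  proof (intro exI ballI, elim imageE)
    fix u z assume "u \<in> X \<times> X" "z = N' u"
    then show "cmod z \<le> cmod D' * B"
      using B N'_eq by (simp add: norm_mult mult_left_mono)
  qed
  then have "uniform_limit (X \<times> X) (\<lambda>n u. N n u / D n) (\<lambda>u. N' u / D') sequentially"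
    using \<open>D' \<noteq> 0\<close> by (intro uniform_lim_divide[OF N_lim D_lim, of "cmod D'"]) auto
  then have "uniform_limit (X \<times> X) (\<lambda>n u. cmod (N n u / D n)) (\<lambda>u. cmod (N' u / D')) sequentially"
    by (rule uniform_limit_norm)
  also have "?this \<longleftrightarrow> ?thesis"
  proof (rule uniform_limit_cong)
    show "\<forall>\<^sub>F n in sequentially. \<forall>u\<in>X \<times> X. cmod (N n u / D n) = (case u of (x, y) \<Rightarrow>
      cmod (Determinant.det (mat (Suc l) (Suc l) (\<lambda>(i, j). cosine n ((xs @ [x]) ! i) ((ys @ [y]) ! j)))
        / Determinant.det (mat l l (\<lambda>(i, j). cosine n (xs ! i) (ys ! j)))))"
      using eventually_p_nonzero
    proof (eventually_elim, intro ballI)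
      fix n u assume n: "\<forall>x\<in>X. p n x \<noteq> 0" and u: "u \<in> X \<times> X"
      have "cmod (N n u) = cmod (Determinant.det (mat (Suc l) (Suc l)
          (\<lambda>(i, j). cosine n ((xs @ [fst u]) ! i) ((ys @ [snd u]) ! j))))"
        unfolding N_def using u by (intro cmod_det_phased_cosine n mem') auto
      moreover have "cmod (D n) = cmod (Determinant.det (mat l l (\<lambda>(i, j). cosine n (xs ! i) (ys ! j))))"
        unfolding D_def by (intro cmod_det_phased_cosine n mem)
      ultimately show "cmod (N n u / D n) = (case u of (x, y) \<Rightarrow>
        cmod (Determinant.det (mat (Suc l) (Suc l) (\<lambda>(i, j). cosine n ((xs @ [x]) ! i) ((ys @ [y]) ! j)))
          / Determinant.det (mat l l (\<lambda>(i, j). cosine n (xs ! i) (ys ! j)))))"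
        by (cases u) (simp add: norm_divide)
    qed
  next
    fix u assume u: "u \<in> X \<times> X"
    have flip: "cmod (g a - g b) = cmod (g b - g a)" "cmod (cnj (g a) - cnj (g b)) = cmod (g b - g a)" for a b
      by (simp_all add: norm_minus_commute flip: complex_cnj_diff)
    have s: "cmod (complex_of_real (sqrt (1 - (cmod (g x))\<^sup>2))) = sqrt (1 - (cmod (g x))\<^sup>2)" if "x \<in> X" for x
      using g_less_one[OF that] by (simp add: abs_square_le_1)
    have "cmod (N' u / D') = cmod (R u)"
      using N'_eq[OF u] \<open>D' \<noteq> 0\<close> by simp
    also have "\<dots> = sqrt ((1 - (cmod (g (fst u)))\<^sup>2) * (1 - (cmod (g (snd u)))\<^sup>2))
        / cmod (1 - g (fst u) * cnj (g (snd u)))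
        * (\<Prod>j<l. cmod ((g (snd u) - g (ys ! j)) / (1 - g (xs ! j) * cnj (g (snd u)))
            * ((g (fst u) - g (xs ! j)) / (1 - g (fst u) * cnj (g (ys ! j))))))"
    proof -
      have "cmod ((g (xs ! j) - g (fst u)) / (1 - g (xs ! j) * cnj (g (snd u)))
          * ((cnj (g (ys ! j)) - cnj (g (snd u))) / (1 - g (fst u) * cnj (g (ys ! j)))))
        = cmod ((g (snd u) - g (ys ! j)) / (1 - g (xs ! j) * cnj (g (snd u)))
            * ((g (fst u) - g (xs ! j)) / (1 - g (fst u) * cnj (g (ys ! j)))))" for j
        by (simp only: norm_mult norm_divide flip(1)[of "xs ! j" "fst u"] flip(2)[of "ys ! j" "snd u"]
            times_divide_times_eq mult_ac)
      then have P: "cmod (\<Prod>j<l. (g (xs ! j) - g (fst u)) / (1 - g (xs ! j) * cnj (g (snd u)))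
          * ((cnj (g (ys ! j)) - cnj (g (snd u))) / (1 - g (fst u) * cnj (g (ys ! j)))))
        = (\<Prod>j<l. cmod ((g (snd u) - g (ys ! j)) / (1 - g (xs ! j) * cnj (g (snd u)))
            * ((g (fst u) - g (xs ! j)) / (1 - g (fst u) * cnj (g (ys ! j))))))"
        unfolding prod_norm[symmetric] by (intro prod.cong refl)
      have "cmod (R u) = sqrt (1 - (cmod (g (fst u)))\<^sup>2) * sqrt (1 - (cmod (g (snd u)))\<^sup>2)
          * (1 / cmod (1 - g (fst u) * cnj (g (snd u))) * cmod (\<Prod>j<l. (g (xs ! j) - g (fst u)) / (1 - g (xs ! j) * cnj (g (snd u)))
          * ((cnj (g (ys ! j)) - cnj (g (snd u))) / (1 - g (fst u) * cnj (g (ys ! j))))))"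
        using u by (simp only: R_def norm_mult norm_divide norm_one s mem_Times_iff)
      then show ?thesis
        unfolding P real_sqrt_mult by (simp only: divide_inverse mult_1_left mult.assoc)
    qed
    finally show "cmod (N' u / D') = (case u of (x, y) \<Rightarrow>
        sqrt ((1 - (cmod (g x))\<^sup>2) * (1 - (cmod (g y))\<^sup>2)) / cmod (1 - g x * cnj (g y))
        * (\<Prod>j<l. cmod ((g y - g (ys ! j)) / (1 - g (xs ! j) * cnj (g y))
            * ((g x - g (xs ! j)) / (1 - g x * cnj (g (ys ! j)))))))"
      by (simp add: case_prod_beta)
  qed
  finally show ?thesis .
qed

end

section \<open>Cosine functions and determinants of orthonormal polynomials\<close>

theorem theorem5p1:
  fixes \<mu> :: "complex measure" and U \<Omega> F :: "complex set" and g :: "complex \<Rightarrow> complex"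
  assumes "sets \<mu> = sets borel" and "finite_measure \<mu>"
    and "compact (measure_support \<mu>)" and "infinite (measure_support \<mu>)"
    and "U \<in> components (- measure_support \<mu>)" and "\<not> bounded U"
    and "open \<Omega>" and "connected \<Omega>" and "\<Omega> \<noteq> {}" and "\<Omega> \<subseteq> U"
    and "g analytic_on \<Omega>" and "\<forall>z\<in>\<Omega>. g z \<noteq> 0"
    and "\<And>K. compact K \<Longrightarrow> K \<subseteq> \<Omega> \<Longrightarrow>
           uniform_limit K
             (\<lambda>n z. poly (orthonormal_poly \<mu> n) z / poly (orthonormal_poly \<mu> (Suc n)) z)
             g sequentially"
    and "compact F" and "F \<subseteq> \<Omega>"
  shows "uniform_limit F (\<lambda>n z. 1 / CD_kernel \<mu> n z z) (\<lambda>z. 0) sequentially \<and>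
    uniform_limit (F \<times> F)
      (\<lambda>n (z, w). cosine_fun \<mu> n z w
         * (complex_of_real (cmod (poly (orthonormal_poly \<mu> n) z)) / poly (orthonormal_poly \<mu> n) z)
         * (poly (orthonormal_poly \<mu> n) w / complex_of_real (cmod (poly (orthonormal_poly \<mu> n) w))))
      (\<lambda>(z, w). complex_of_real (sqrt ((1 - (cmod (g z))\<^sup>2) * (1 - (cmod (g w))\<^sup>2)))
         / (1 - g z * cnj (g w)))
      sequentially \<and>
    (\<forall>l zs ws. length zs = l \<longrightarrow> length ws = l \<longrightarrow> set zs \<subseteq> \<Omega> \<longrightarrow> set ws \<subseteq> \<Omega> \<longrightarrow>
       distinct (map g zs) \<longrightarrow> distinct (map g ws) \<longrightarrow>
       uniform_limit (F \<times> F)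
         (\<lambda>n (z, w). cmod (Determinant.det (cosine_mat \<mu> n (zs @ [z]) (ws @ [w]))
            / Determinant.det (cosine_mat \<mu> n zs ws)))
         (\<lambda>(z, w). sqrt ((1 - (cmod (g z))\<^sup>2) * (1 - (cmod (g w))\<^sup>2))
            / cmod (1 - g z * cnj (g w))
            * (\<Prod>j<l. cmod ((g w - g (ws ! j)) / (1 - g (zs ! j) * cnj (g w))
                * ((g z - g (zs ! j)) / (1 - g z * cnj (g (ws ! j)))))))
         sequentially)"
proof -
  define p where "p n z = poly (orthonormal_poly \<mu> n) z" for n z
  have p: "orthonormal_polys \<mu> (orthonormal_poly \<mu>)"
    using assms(1-4) by (rule orthonormal_poly)
  have g_less_one: "cmod (g z) < 1" if "z \<in> \<Omega>" for z
  proof (rule ratio_limit_less_one[OF assms(1-4) p assms(5,6)])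
    show "z \<in> U"
      using that assms(10) by blast
    show "(\<lambda>n. poly (orthonormal_poly \<mu> n) z / poly (orthonormal_poly \<mu> (Suc n)) z) \<longlonglongrightarrow> g z"
      using assms(13)[of "{z}"] that by simp
  qed
  \<comment> \<open>The nodes of the determinants may lie outside \<open>F\<close>, so finite sets are adjoined to it.\<close>
  have ratio: "ratio_asymptotics (F \<union> E) p g" if E: "finite E" "E \<subseteq> \<Omega>" for E
  proof
    show "compact (F \<union> E)"
      using compact_Un[OF assms(14) finite_imp_compact[OF E(1)]] .
    have sub: "F \<union> E \<subseteq> \<Omega>"
      using E(2) assms(15) by blast
    show "continuous_on (F \<union> E) (p n)" for n
      unfolding p_def by (intro continuous_intros)
    show "continuous_on (F \<union> E) g"
      using assms(11) sub analytic_imp_holomorphic continuous_on_subset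
        holomorphic_on_imp_continuous_on by blast
    show "g x \<noteq> 0" "cmod (g x) < 1" if "x \<in> F \<union> E" for x
      using that sub assms(12) g_less_one by blast+
    show "uniform_limit (F \<union> E) (\<lambda>n x. p n x / p (Suc n) x) g sequentially"
      unfolding p_def using \<open>compact (F \<union> E)\<close> sub by (rule assms(13))
  qed
  interpret R: ratio_asymptotics F p g
    using ratio[of "{}"] by simp
  have kernel: "CD_kernel \<mu> n z w = R.kernel n z w" for n z w
    by (simp add: CD_kernel_def R.kernel_def p_def)
  have cosine: "cosine_fun \<mu> n z w = R.cosine n z w" for n z w
    by (simp add: cosine_fun_def R.cosine_def kernel)
  show ?thesis
  proof (intro conjI allI impI)
    show "uniform_limit F (\<lambda>n z. 1 / CD_kernel \<mu> n z z) (\<lambda>z. 0) sequentially"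
      unfolding kernel by (rule R.inverse_kernel_limit)
  next
    show "uniform_limit (F \<times> F)
      (\<lambda>n (z, w). cosine_fun \<mu> n z w
         * (complex_of_real (cmod (poly (orthonormal_poly \<mu> n) z)) / poly (orthonormal_poly \<mu> n) z)
         * (poly (orthonormal_poly \<mu> n) w / complex_of_real (cmod (poly (orthonormal_poly \<mu> n) w))))
      (\<lambda>(z, w). complex_of_real (sqrt ((1 - (cmod (g z))\<^sup>2) * (1 - (cmod (g w))\<^sup>2)))
         / (1 - g z * cnj (g w)))
      sequentially"
      using R.phased_cosine_limit
      by (simp only: R.phased_cosine_def R.cosine_limit_def cosine p_def)
  next
    fix l and zs ws :: "complex list"
    assume h: "length zs = l" "length ws = l" "set zs \<subseteq> \<Omega>" "set ws \<subseteq> \<Omega>"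
      "distinct (map g zs)" "distinct (map g ws)"
    interpret E: ratio_asymptotics "F \<union> (set zs \<union> set ws)" p g
      using h by (intro ratio) auto
    have cosine': "cosine_fun \<mu> n z w = E.cosine n z w" for n z w
      by (simp add: cosine_fun_def E.cosine_def E.kernel_def CD_kernel_def p_def)
    have "uniform_limit (F \<times> F)
       (\<lambda>n (x, y). cmod (Determinant.det (mat (Suc l) (Suc l) (\<lambda>(i, j). E.cosine n ((zs @ [x]) ! i) ((ws @ [y]) ! j)))
          / Determinant.det (mat l l (\<lambda>(i, j). E.cosine n (zs ! i) (ws ! j)))))
       (\<lambda>(x, y). sqrt ((1 - (cmod (g x))\<^sup>2) * (1 - (cmod (g y))\<^sup>2))
          / cmod (1 - g x * cnj (g y))
          * (\<Prod>j<l. cmod ((g y - g (ws ! j)) / (1 - g (zs ! j) * cnj (g y))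
              * ((g x - g (zs ! j)) / (1 - g x * cnj (g (ws ! j)))))))
       sequentially"
      by (rule uniform_limit_on_subset[OF E.det_ratio_limit]) (use h in auto)
    then show "uniform_limit (F \<times> F)
         (\<lambda>n (z, w). cmod (Determinant.det (cosine_mat \<mu> n (zs @ [z]) (ws @ [w]))
            / Determinant.det (cosine_mat \<mu> n zs ws)))
         (\<lambda>(z, w). sqrt ((1 - (cmod (g z))\<^sup>2) * (1 - (cmod (g w))\<^sup>2))
            / cmod (1 - g z * cnj (g w))
            * (\<Prod>j<l. cmod ((g w - g (ws ! j)) / (1 - g (zs ! j) * cnj (g w))
                * ((g z - g (zs ! j)) / (1 - g z * cnj (g (ws ! j)))))))
         sequentially"
      using h(1,2) by (simp add: cosine_mat_def cosine')
  qed
qed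

end
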